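(* For every positive integer $n$, $C_1(\mathbb{Q}^n) - c_1(\mathbb{Q}^n) \leq 3$.
   Context: For a positive integer $n$ and $d>0$, $G(\mathbb{Q}^n,d)$ denotes the graph with vertex set $\mathbb{Q}^n$ in which two points are adjacent if and only if their Euclidean distance is exactly $d$, and $\omega(\mathbb{Q}^n,d)$ denotes its clique number, i.e. the largest $m$ such that there are $m$ points of $\mathbb{Q}^n$ pairwise at Euclidean distance exactly $d$. The clique number of $\mathbb{Q}^n$ is $C_1(\mathbb{Q}^n)=\max\{\omega(\mathbb{Q}^n,d): d>0\}$, and the lower clique number is $c_1(\mathbb{Q}^n)=\min\{\omega(\mathbb{Q}^n,d): d>0 \text{ and } d \text{ is realized as the distance between two points of } \mathbb{Q}^n\}$. *)

theory Defs
  imports "HOL-Analysis.Analysis"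
begin

definition rational_points :: "(real ^ 'n) set" where
  "rational_points = {x. \<forall>i. x $ i \<in> \<rat>}"

definition dist_adj :: "'a::metric_space set \<Rightarrow> real \<Rightarrow> 'a \<Rightarrow> 'a \<Rightarrow> bool" where
  "dist_adj X d x y \<longleftrightarrow> x \<in> X \<and> y \<in> X \<and> dist x y = d"

definition dist_clique :: "'a::metric_space set \<Rightarrow> real \<Rightarrow> 'a set \<Rightarrow> bool" where
  "dist_clique X d S \<longleftrightarrow> S \<subseteq> X \<and> pairwise (dist_adj X d) S"

text \<open>The maxima below are meaningful when the clique sizes are bounded; for subsets of
  Euclidean n-space and positive d they are at most n + 1.\<close>

definition dist_clique_number :: "'a::metric_space set \<Rightarrow> real \<Rightarrow> nat" where
  "dist_clique_number X d = Max {card S | S. finite S \<and> dist_clique X d S}"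

definition upper_clique_number :: "'a::metric_space set \<Rightarrow> nat" where
  "upper_clique_number X = Max {dist_clique_number X d | d. d > 0}"

definition lower_clique_number :: "'a::metric_space set \<Rightarrow> nat" where
  "lower_clique_number X =
     Min {dist_clique_number X d | d. d > 0 \<and> (\<exists>x\<in>X. \<exists>y\<in>X. dist x y = d)}"

end

theory Submission
  imports Defs "HOL-Number_Theory.Number_Theory" "HOL-Computational_Algebra.Squarefree"
begin

text \<open>
  Equidistant points in \<open>n\<close>-space number at most \<open>n + 1\<close>, so it suffices to find \<open>n - 2\<close> rational
  points at mutual distance \<open>d\<close> whenever \<open>d\<^sup>2 = 2 * c\<close> is a positive rational.
  Write \<open>n = 4 * k + r\<close> with \<open>r < 4\<close>.
  Since \<open>c\<close> is a sum of four rational squares, quaternion multiplication gives \<open>4 * k\<close> orthogonal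
  rational vectors of squared length \<open>c\<close>, whose end points are \<open>4 * k\<close> points as required; this
  settles \<open>r \<le> 2\<close>. For \<open>r = 3\<close> one more point is needed. Looking for it above a multiple \<open>\<mu>\<close> of the
  sum of these vectors, one has to write \<open>c * (1 + 2 * \<mu> - 4 * k * \<mu>\<^sup>2)\<close> as a sum of three rational
  squares, and \<open>\<mu>\<close> can be chosen such that this number is, up to squares, \<open>s\<close> or \<open>2 * s\<close> with
  \<open>s\<close> congruent to 1 modulo 4. Such numbers are sums of three integer squares.

  For the latter let \<open>m\<close> be such a number, squarefree. If there is a positive \<open>q\<close>, coprime to \<open>m\<close>,
  such that \<open>- q\<close> is a square modulo \<open>m\<close> and \<open>- m\<close> is a square modulo \<open>q\<close>, then \<open>m\<close> is represented by
  a unimodular positive definite ternary form, and the only such form is \<open>x\<^sup>2 + y\<^sup>2 + z\<^sup>2\<close>.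
  Usually a prime \<open>q\<close> is provided by Dirichlet's theorem. A composite \<open>q\<close> suffices, however, and it is
  obtained in an elementary way: with \<open>\<chi> = (- m / \<cdot>)\<close> and \<open>R n = (\<Sum>d | d dvd n. \<chi> d)\<close>, an odd power
  of a prime \<open>p\<close> with \<open>\<chi> p = - 1\<close> exactly dividing \<open>n\<close> forces \<open>R n = 0\<close>. The sum of \<open>R n / sqrt n\<close>
  over those \<open>n \<le> y\<^sup>2\<close> on which all genus characters have prescribed values (with product 1) is
  unbounded: detecting these values by characters, all terms but two equal ones are bounded by
  Dirichlet's hyperbola method, and those two are at least the harmonic sum over the squares \<open>n\<close>.
\<close>

section \<open>Unimodular ternary forms\<close>

text \<open>The matrix with diagonal \<open>a, b, c\<close> and off-diagonal entries \<open>d\<close> (12), \<open>e\<close> (13), \<open>f\<close> (23).\<close>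

definition int_gram :: "int \<Rightarrow> int \<Rightarrow> int \<Rightarrow> int \<Rightarrow> int \<Rightarrow> int \<Rightarrow> bool" where
  "int_gram a b c d e f \<longleftrightarrow> (\<exists>x1 y1 z1 x2 y2 z2 x3 y3 z3.
     a = x1 * x1 + y1 * y1 + z1 * z1 \<and> b = x2 * x2 + y2 * y2 + z2 * z2 \<and>
     c = x3 * x3 + y3 * y3 + z3 * z3 \<and> d = x1 * x2 + y1 * y2 + z1 * z2 \<and>
     e = x1 * x3 + y1 * y3 + z1 * z3 \<and> f = x2 * x3 + y2 * y3 + z2 * z3)"

lemma int_gramI:
  "int_gram (x1 * x1 + y1 * y1 + z1 * z1) (x2 * x2 + y2 * y2 + z2 * z2)
    (x3 * x3 + y3 * y3 + z3 * z3) (x1 * x2 + y1 * y2 + z1 * z2)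
    (x1 * x3 + y1 * y3 + z1 * z3) (x2 * x3 + y2 * y3 + z2 * z3)"
  unfolding int_gram_def by blast

lemma int_gram_swap12:
  assumes "int_gram b a c d f e"
  shows "int_gram a b c d e f"
proof -
  from assms obtain x1 y1 z1 x2 y2 z2 x3 y3 z3 where
    "b = x1 * x1 + y1 * y1 + z1 * z1" "a = x2 * x2 + y2 * y2 + z2 * z2"
    "c = x3 * x3 + y3 * y3 + z3 * z3" "d = x1 * x2 + y1 * y2 + z1 * z2"
    "f = x1 * x3 + y1 * y3 + z1 * z3" "e = x2 * x3 + y2 * y3 + z2 * z3"
    unfolding int_gram_def by blast
  then show ?thesis
    using int_gramI[of x2 y2 z2 x1 y1 z1 x3 y3 z3] by (simp add: mult.commute)
qed

lemma int_gram_swap23: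
  assumes "int_gram a c b e d f"
  shows "int_gram a b c d e f"
proof -
  from assms obtain x1 y1 z1 x2 y2 z2 x3 y3 z3 where
    "a = x1 * x1 + y1 * y1 + z1 * z1" "c = x2 * x2 + y2 * y2 + z2 * z2"
    "b = x3 * x3 + y3 * y3 + z3 * z3" "e = x1 * x2 + y1 * y2 + z1 * z2"
    "d = x1 * x3 + y1 * y3 + z1 * z3" "f = x2 * x3 + y2 * y3 + z2 * z3"
    unfolding int_gram_def by blast
  then show ?thesis
    using int_gramI[of x1 y1 z1 x3 y3 z3 x2 y2 z2] by (simp add: mult.commute)
qed

text \<open>The hypothesis describes the form after adding \<open>k\<close> times the second basis
  vector to the third; subtracting \<open>k\<close> times the second integer vector from the third
  undoes this.\<close>

lemma int_gram_shift3:
  assumes "int_gram a b (c + 2 * k * f + k * k * b) d (e + k * d) (f + k * b)"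
  shows "int_gram a b c d e f"
proof -
  from assms obtain x1 y1 z1 x2 y2 z2 x3 y3 z3 where
    eqs: "a = x1 * x1 + y1 * y1 + z1 * z1" "b = x2 * x2 + y2 * y2 + z2 * z2"
    "c + 2 * k * f + k * k * b = x3 * x3 + y3 * y3 + z3 * z3" "d = x1 * x2 + y1 * y2 + z1 * z2"
    "e + k * d = x1 * x3 + y1 * y3 + z1 * z3" "f + k * b = x2 * x3 + y2 * y3 + z2 * z3"
    unfolding int_gram_def by blast
  let ?x = "x3 - k * x2" and ?y = "y3 - k * y2" and ?z = "z3 - k * z2"
  have f: "f = x2 * ?x + y2 * ?y + z2 * ?z"
    using eqs(2,6) by (simp add: algebra_simps)
  have e: "e = x1 * ?x + y1 * ?y + z1 * ?z"
    using eqs(4,5) by (simp add: algebra_simps)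
  have "c = (x3 * x3 + y3 * y3 + z3 * z3) - 2 * k * f - k * k * b"
    using eqs(3) by simp
  also have "\<dots> = ?x * ?x + ?y * ?y + ?z * ?z"
    unfolding f eqs(2) by Groebner_Basis.algebra
  finally show ?thesis
    using int_gramI[of x1 y1 z1 x2 y2 z2 ?x ?y ?z] e f eqs(1,2,4) by metis
qed

lemma int_gram_shift2:
  assumes "int_gram a (b + 2 * k * d + k * k * a) c (d + k * a) e (f + k * e)"
  shows "int_gram a b c d e f"
proof -
  have "int_gram c a (b + 2 * k * d + k * k * a) e (f + k * e) (d + k * a)"
    by (rule int_gram_swap12, rule int_gram_swap23, rule assms)
  then have "int_gram c a b e f d"
    by (rule int_gram_shift3)
  then show ?thesis
    by (intro int_gram_swap23[of a c b] int_gram_swap12[of c a b])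
qed

lemma exists_centred_residue:
  fixes a d :: int
  assumes "a > 0"
  shows "\<exists>k. 2 * \<bar>d + k * a\<bar> \<le> a"
proof -
  define q r where "q = (2 * d + a) div (2 * a)" and "r = (2 * d + a) mod (2 * a)"
  have "2 * d + a = 2 * (q * a) + r"
    using div_mult_mod_eq[of "2 * d + a" "2 * a"] unfolding q_def r_def by linarith
  moreover have "0 \<le> r" "r < 2 * a"
    using assms by (simp_all add: r_def)
  ultimately have "d - q * a \<le> a - (d - q * a)" "- (d - q * a) \<le> a + (d - q * a)"
    by linarith+
  then have "2 * \<bar>d - q * a\<bar> \<le> a"
    by (simp add: mult.commute split: abs_split)
  then show ?thesis
    by (intro exI[of _ "- q"]) simp
qed

text \<open>Reduction by a lexicographic descent: on \<open>a\<close>, then on the leading minor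
  \<open>a * b - d * d\<close>. Once neither swapping the first two basis vectors nor the last two
  lowers these, size bounds force both to be 1.\<close>

theorem unimodular_ternary_int_gram:
  assumes "a > 0" "a * b - d * d > 0"
    and "a * b * c + 2 * d * e * f - a * f * f - b * e * e - c * d * d = 1"
  shows "int_gram a b c d e f"
  using assms
proof (induction "nat a" arbitrary: a b c d e f rule: less_induct)
  case outer: less
  show ?case
    using outer.prems
  proof (induction "nat (a * b - d * d)" arbitrary: b c d e f rule: less_induct)
    case less
    have a: "a > 0"
      by fact
    obtain k where k: "2 * \<bar>d + k * a\<bar> \<le> a"
      using exists_centred_residue[OF a] by blast
    define b1 d1 f1 where "b1 = b + 2 * k * d + k * k * a" and "d1 = d + k * a" and "f1 = f + k * e"
    define B where "B = a * b1 - d1 * d1"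
    have B_eq: "B = a * b - d * d"
      unfolding B_def b1_def d1_def by Groebner_Basis.algebra
    with less.prems have B: "B > 0"
      by simp
    \<comment> \<open>Adding \<open>l\<close> times the second basis vector to the third changes the
      minor \<open>a * f1 - d1 * e\<close> by \<open>l * B\<close>, so this minor can be centred
      modulo \<open>B\<close>.\<close>
    obtain l where l: "2 * \<bar>(a * f1 - d1 * e) + l * B\<bar> \<le> B"
      using exists_centred_residue[OF B] by blast
    define c2 e2 f2 where "c2 = c + 2 * l * f1 + l * l * b1"
      and "e2 = e + l * d1" and "f2 = f1 + l * b1"
    define E C where "E = a * f2 - d1 * e2" and "C = a * c2 - e2 * e2"
    have d1: "2 * \<bar>d1\<bar> \<le> a"
      using k by (simp add: d1_def)
    have "E = (a * f1 - d1 * e) + l * B"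
      unfolding E_def f2_def e2_def B_def by Groebner_Basis.algebra
    with l have E: "2 * \<bar>E\<bar> \<le> B"
      by simp
    have det: "a * b1 * c2 + 2 * d1 * e2 * f2 - a * f2 * f2 - b1 * e2 * e2 - c2 * d1 * d1 = 1"
    proof -
      have "a * b1 * c2 + 2 * d1 * e2 * f2 - a * f2 * f2 - b1 * e2 * e2 - c2 * d1 * d1 =
          a * b1 * c + 2 * d1 * e * f1 - a * f1 * f1 - b1 * e * e - c * d1 * d1"
        unfolding c2_def e2_def f2_def by Groebner_Basis.algebra
      also have "\<dots> = a * b * c + 2 * d * e * f - a * f * f - b * e * e - c * d * d"
        unfolding b1_def d1_def f1_def by Groebner_Basis.algebra
      finally show ?thesis
        using less.prems(3) by simp
    qed
    \<comment> \<open>Sylvester's identity: for the minors bordering the corner \<open>a\<close>,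
      \<open>B * C - E * E\<close> is \<open>a\<close> times the determinant, which is 1.\<close>
    have BC: "B * C = a + E * E"
    proof -
      have "B * C - E * E =
          a * (a * b1 * c2 + 2 * d1 * e2 * f2 - a * f2 * f2 - b1 * e2 * e2 - c2 * d1 * d1)"
        unfolding B_def C_def E_def by Groebner_Basis.algebra
      then show ?thesis
        using det by simp
    qed
    have C: "C > 0"
    proof -
      have "B * C > 0"
        using BC a by (simp add: add_pos_nonneg)
      then show ?thesis
        using B by (simp add: zero_less_mult_iff)
    qed
    have "int_gram a b1 c2 d1 e2 f2"
    proof -
      consider "b1 < a" | "C < B" | "a \<le> b1" "B \<le> C"
        by linarith
      then show ?thesis
      proof cases
        case 1
        have "a * b1 > 0"
          using B unfolding B_def by (smt (verit) zero_le_square)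
        then have "b1 > 0"
          using a by (simp add: zero_less_mult_iff)
        moreover have "b1 * a - d1 * d1 > 0"
          using B by (simp add: B_def mult.commute)
        moreover have "b1 * a * c2 + 2 * d1 * f2 * e2 - b1 * e2 * e2 - a * f2 * f2 - c2 * d1 * d1 = 1"
          using det by Groebner_Basis.algebra
        ultimately have "int_gram b1 a c2 d1 f2 e2"
          using 1 outer.hyps by simp
        then show ?thesis
          by (rule int_gram_swap12)
      next
        case 2
        have "a * c2 * b1 + 2 * e2 * d1 * f2 - a * f2 * f2 - c2 * d1 * d1 - b1 * e2 * e2 = 1"
          using det by Groebner_Basis.algebra
        then have "int_gram a c2 b1 e2 d1 f2"
          using 2 C a B_eq unfolding C_def by (intro less.hyps) auto
        then show ?thesis
          by (rule int_gram_swap23)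
      next
        case 3
        \<comment> \<open>If neither swap helps, then \<open>3 * B^2 <= 4 * a\<close> and
          \<open>3 * a^2 <= 4 * B\<close>, which leaves only \<open>a = B = 1\<close>.\<close>
        have "4 * (E * E) \<le> B * B"
          using mult_mono[OF E E] B by (simp add: abs_mult_self_eq)
        moreover have "B * B \<le> B * C"
          using 3 B by simp
        ultimately have B_le: "3 * (B * B) \<le> 4 * a"
          using BC by linarith
        have "4 * (d1 * d1) \<le> a * a"
          using mult_mono[OF d1 d1] a by (simp add: abs_mult_self_eq)
        moreover have "a * a \<le> a * b1"
          using 3 a by simp
        ultimately have B_ge: "3 * (a * a) \<le> 4 * B"
          using B_def by linarith
        have "a < 2"
        proof (rule ccontr)
          assume "\<not> a < 2"
          then have "2 * a \<le> a * a" "4 \<le> a * a"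
            using mult_mono[of 2 a 2 a] by simp_all
          then have "3 * a \<le> 2 * B" "B \<ge> 3"
            using B_ge by linarith+
          moreover from this have "3 * B \<le> B * B"
            by simp
          ultimately show False
            using B_le by linarith
        qed
        with a have a1: "a = 1"
          by simp
        with d1 have d0: "d1 = 0"
          by simp
        have "B < 2"
        proof (rule ccontr)
          assume "\<not> B < 2"
          then have "4 \<le> B * B"
            using mult_mono[of 2 B 2 B] by simp
          then show False
            using B_le a1 by linarith
        qed
        with B have "B = 1"
          by simp
        then have "b1 = 1" "f2 = 0"
          using E a1 d0 by (simp_all add: B_def E_def)
        moreover have "c2 = e2 * e2 + 1"
          using BC \<open>B = 1\<close> \<open>f2 = 0\<close> a1 d0 by (simp add: C_def E_def)
        ultimately have "int_gram a b1 c2 d1 e2 f2 = int_gram 1 1 (e2 * e2 + 1) 0 e2 0"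
          using a1 d0 by simp
        \<comment> \<open>Gram matrix of \<open>(1, 0, 0)\<close>, \<open>(0, 1, 0)\<close> and
          \<open>(e2, 0, 1)\<close>.\<close>
        also have "\<dots>"
          unfolding int_gram_def
          by (rule exI[of _ 1], rule exI[of _ 0], rule exI[of _ 0],
              rule exI[of _ 0], rule exI[of _ 1], rule exI[of _ 0],
              rule exI[of _ e2], rule exI[of _ 0], rule exI[of _ 1]) simp
        finally show ?thesis .
      qed
    qed
    then have "int_gram a b1 c d1 e f1"
      unfolding c2_def e2_def f2_def by (rule int_gram_shift3)
    then show ?case
      unfolding b1_def d1_def f1_def by (rule int_gram_shift2)
  qed
qed

text \<open>
  With \<open>h = (r\<^sup>2 + m) / a\<close>, the form \<open>(x\<^sup>2 + a * y\<^sup>2 + 2 * r * y * z + h * z\<^sup>2) / m\<close> is integral and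
  unimodular on the lattice spanned by \<open>(m, 0, 0)\<close>, \<open>(t * a, 1, 0)\<close>, \<open>(t * r, 0, 1)\<close>, and its value
  at \<open>(m, 0, 0)\<close> is \<open>m\<close>.
\<close>

theorem sum_three_squares_if_congruences:
  fixes a m r t :: int
  assumes "a > 0" "m > 0" "coprime a m" "m dvd a * t\<^sup>2 + 1" "a dvd r\<^sup>2 + m"
  shows "\<exists>x y z. m = x\<^sup>2 + y\<^sup>2 + z\<^sup>2"
proof -
  obtain u where u: "a * t\<^sup>2 + 1 = m * u"
    using assms(4) by (elim dvdE)
  obtain h where h: "r\<^sup>2 + m = a * h"
    using assms(5) by (elim dvdE)
  have at: "a * t\<^sup>2 = m * u - 1"
    using u by simp
  have "a * (t\<^sup>2 * r\<^sup>2 + h) = (a * t\<^sup>2) * r\<^sup>2 + a * h"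
    by (simp add: algebra_simps)
  also have "\<dots> = m * (u * r\<^sup>2 + 1)"
    unfolding at h[symmetric] by (simp add: algebra_simps)
  finally have avr: "a * (t\<^sup>2 * r\<^sup>2 + h) = m * (u * r\<^sup>2 + 1)" .
  \<comment> \<open>The quotient \<open>v\<close> will be the value of the form at the third lattice
    vector; its integrality is seen after multiplying by \<open>a\<close>, which is coprime to
    \<open>m\<close>.\<close>
  then have "m dvd a * (t\<^sup>2 * r\<^sup>2 + h)"
    by simp
  then have "m dvd t\<^sup>2 * r\<^sup>2 + h"
    using assms(3) by (simp add: coprime_commute coprime_dvd_mult_right_iff)
  then obtain v where v: "t\<^sup>2 * r\<^sup>2 + h = m * v"
    by (elim dvdE)
  have minor: "m * (a * u) - (t * a) * (t * a) = a"
  proof -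
    have "m * (a * u) - (t * a) * (t * a) = a * (m * u - a * t\<^sup>2)"
      by (simp add: algebra_simps power2_eq_square)
    then show ?thesis
      using at by simp
  qed
  have "m * (a * v) = m * (u * r\<^sup>2 + 1)"
    using avr v by (simp add: mult.left_commute)
  then have av: "a * v = u * r\<^sup>2 + 1"
    using assms(2) by simp
  have "m * (a * u) * v + 2 * (t * a) * (t * r) * (r * u) - m * (r * u) * (r * u)
      - (a * u) * (t * r) * (t * r) - v * (t * a) * (t * a) =
      v * (m * (a * u) - (t * a) * (t * a)) + u * r\<^sup>2 * (a * t\<^sup>2 - m * u)"
    by (simp add: algebra_simps power2_eq_square)
  also have "\<dots> = 1"
    unfolding minor at using av by (simp add: algebra_simps)
  finally have "int_gram m (a * u) v (t * a) (t * r) (r * u)"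
    using assms(1,2) minor by (intro unimodular_ternary_int_gram) simp_all
  then have "\<exists>x y z. m = x * x + y * y + z * z"
    unfolding int_gram_def by blast
  then show ?thesis
    by (simp add: power2_eq_square)
qed

section \<open>Sums over a hyperbolic region and over divisors\<close>

text \<open>Abel summation: with the boundary term \<open>T b * w b\<close> split off, the bounds on
  the increments telescope along the decreasing weights.\<close>

lemma weighted_sum_bound:
  fixes g w :: "nat \<Rightarrow> real"
  assumes bound: "\<And>b. \<bar>\<Sum>n\<in>{a..<b}. g n\<bar> \<le> K"
    and antimono: "\<And>n. a \<le> n \<Longrightarrow> w (Suc n) \<le> w n"
    and nonneg: "\<And>n. a \<le> n \<Longrightarrow> 0 \<le> w n"
  shows "\<bar>\<Sum>n\<in>{a..<b}. g n * w n\<bar> \<le> K * w a"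
proof (cases "a \<le> b")
  case True
  define T where "T = (\<lambda>b. \<Sum>n\<in>{a..<b}. g n)"
  have *: "\<bar>(\<Sum>n\<in>{a..<b}. g n * w n) - T b * w b\<bar> \<le> K * (w a - w b)"
    using True
  proof (induction b rule: dec_induct)
    case base
    then show ?case by (simp add: T_def)
  next
    case (step b)
    have "(\<Sum>n\<in>{a..<Suc b}. g n * w n) - T (Suc b) * w (Suc b) =
        ((\<Sum>n\<in>{a..<b}. g n * w n) - T b * w b) + T (Suc b) * (w b - w (Suc b))"
      using step by (simp add: T_def algebra_simps)
    also have "\<bar>\<dots>\<bar> \<le> \<bar>(\<Sum>n\<in>{a..<b}. g n * w n) - T b * w b\<bar>
        + \<bar>T (Suc b)\<bar> * \<bar>w b - w (Suc b)\<bar>"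
      by (metis abs_mult abs_triangle_ineq)
    also have "\<dots> \<le> K * (w a - w b) + K * (w b - w (Suc b))"
    proof -
      have "\<bar>w b - w (Suc b)\<bar> = w b - w (Suc b)"
        using antimono[of b] step by simp
      moreover have "\<bar>T (Suc b)\<bar> \<le> K"
        unfolding T_def by (rule bound)
      ultimately show ?thesis
        using step.IH antimono[of b] step by (intro add_mono mult_mono) auto
    qed
    finally show ?case
      by (simp add: algebra_simps)
  qed
  have "\<bar>T b * w b\<bar> \<le> K * w b"
    using bound[of b] nonneg[OF True] by (simp add: T_def abs_mult mult_right_mono)
  moreover have "K * (w a - w b) = K * w a - K * w b"
    by (simp add: right_diff_distrib)
  ultimately show ?thesis
    using * by linarith
next
  case False
  have "0 \<le> K"
    using bound[of a] by simp
  with False nonneg[of a] show ?thesis by simp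
qed

lemma sum_inverse_sqrt_le: "(\<Sum>n = 1..y. 1 / sqrt (real n)) \<le> 2 * sqrt (real y)"
proof (induction y)
  case 0
  then show ?case by simp
next
  case (Suc y)
  \<comment> \<open>This square yields
    \<open>1 / sqrt (y + 1) <= 2 * (sqrt (y + 1) - sqrt y)\<close>, so the sum telescopes.\<close>
  have "(sqrt (real (Suc y)) - sqrt (real y))\<^sup>2 \<ge> 0"
    by simp
  then have "2 * sqrt (real (Suc y)) * sqrt (real y) \<le> 2 * real y + 1"
    by (simp add: power2_diff)
  then have "1 \<le> 2 * (sqrt (real (Suc y)) - sqrt (real y)) * sqrt (real (Suc y))"
    by (simp add: algebra_simps)
  then have "1 / sqrt (real (Suc y)) \<le> 2 * (sqrt (real (Suc y)) - sqrt (real y))"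
    by (simp add: divide_le_eq)
  with Suc show ?case
    by simp
qed

text \<open>Dirichlet's hyperbola method. The square \<open>d, e <= y\<close> gives a product of two
  sums, each at most \<open>K\<close>. On either remaining wing the inner sum is at most
  \<open>K / sqrt (y + 1)\<close> by partial summation, while the outer weights add up to at most
  \<open>2 * sqrt y\<close>.\<close>

lemma hyperbola_sum_bound:
  fixes f g :: "nat \<Rightarrow> real"
  assumes f: "\<And>a b. \<bar>\<Sum>n\<in>{a..<b}. f n\<bar> \<le> K" "\<And>n. \<bar>f n\<bar> \<le> 1"
    and g: "\<And>a b. \<bar>\<Sum>n\<in>{a..<b}. g n\<bar> \<le> K" "\<And>n. \<bar>g n\<bar> \<le> 1"
  shows "\<bar>\<Sum>(d, e) | 1 \<le> d \<and> 1 \<le> e \<and> d * e \<le> y\<^sup>2. f d * g e / sqrt (real (d * e))\<bar>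
    \<le> K\<^sup>2 + 4 * K"
proof -
  define w where "w = (\<lambda>n. 1 / sqrt (real n))"
  have K: "0 \<le> K"
    using f(1)[of 0 0] by simp
  have tail: "\<bar>\<Sum>n\<in>{a..<b}. h n * w n\<bar> \<le> K * w a"
    if "1 \<le> a" "\<And>a b. \<bar>\<Sum>n\<in>{a..<b}. h n\<bar> \<le> K" for h a b
    using that by (intro weighted_sum_bound) (auto simp: w_def frac_le)
  let ?h = "\<lambda>(d, e). (f d * w d) * (g e * w e)"
  \<comment> \<open>\<open>A\<close> is the square, \<open>B\<close> the wing with
    \<open>d <= y < e\<close>, and \<open>C\<close> its mirror image.\<close>
  define A B C where "A = {1..<Suc y} \<times> {1..<Suc y}"
    and "B = (SIGMA d:{1..<Suc y}. {Suc y..<Suc (y\<^sup>2 div d)})"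
    and "C = (\<lambda>(e, d). (d, e)) ` B"
  have side: "\<bar>\<Sum>d\<in>{1..<Suc y}. \<Sum>e\<in>{Suc y..<Suc (y\<^sup>2 div d)}. (u d * w d) * (v e * w e)\<bar> \<le> 2 * K"
    if u: "\<And>n. \<bar>u n\<bar> \<le> 1" and v: "\<And>a b. \<bar>\<Sum>n\<in>{a..<b}. v n\<bar> \<le> K" for u v
  proof -
    have "\<bar>\<Sum>d\<in>{1..<Suc y}. \<Sum>e\<in>{Suc y..<Suc (y\<^sup>2 div d)}. (u d * w d) * (v e * w e)\<bar>
        \<le> (\<Sum>d\<in>{1..<Suc y}. \<bar>\<Sum>e\<in>{Suc y..<Suc (y\<^sup>2 div d)}. (u d * w d) * (v e * w e)\<bar>)"
      by (rule sum_abs)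
    also have "\<dots> \<le> (\<Sum>d\<in>{1..<Suc y}. w d * (K * w (Suc y)))"
    proof (rule sum_mono)
      fix d
      have "(\<Sum>e\<in>{Suc y..<Suc (y\<^sup>2 div d)}. (u d * w d) * (v e * w e)) =
          (u d * w d) * (\<Sum>e\<in>{Suc y..<Suc (y\<^sup>2 div d)}. v e * w e)"
        by (rule sum_distrib_left[symmetric])
      moreover have "\<bar>u d * w d\<bar> \<le> w d"
        using u[of d] by (simp add: abs_mult w_def divide_right_mono)
      moreover have "\<bar>\<Sum>e\<in>{Suc y..<Suc (y\<^sup>2 div d)}. v e * w e\<bar> \<le> K * w (Suc y)"
        by (rule tail[OF _ v]) simp
      moreover have "0 \<le> w d"
        by (simp add: w_def)
      ultimately show "\<bar>\<Sum>e\<in>{Suc y..<Suc (y\<^sup>2 div d)}. (u d * w d) * (v e * w e)\<bar>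
          \<le> w d * (K * w (Suc y))"
        by (simp only: abs_mult) (rule mult_mono; simp)
    qed
    also have "\<dots> = (\<Sum>d = 1..y. w d) * (K * w (Suc y))"
      by (simp add: sum_distrib_right atLeastLessThanSuc_atLeastAtMost)
    also have "\<dots> \<le> (2 * sqrt (real y)) * (K * w (Suc y))"
      using sum_inverse_sqrt_le[of y] K by (intro mult_right_mono) (auto simp: w_def)
    also have "\<dots> = 2 * K * (sqrt (real y) / sqrt (real (Suc y)))"
      by (simp add: w_def)
    also have "\<dots> \<le> 2 * K * 1"
      using K by (intro mult_left_mono) auto
    finally show ?thesis by simp
  qed
  have "{(d, e). 1 \<le> d \<and> 1 \<le> e \<and> d * e \<le> y\<^sup>2} = A \<union> B \<union> C"
  proof (intro equalityI subrelI)
    fix d e :: nat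
    assume "(d, e) \<in> {(d, e). 1 \<le> d \<and> 1 \<le> e \<and> d * e \<le> y\<^sup>2}"
    then have de: "1 \<le> d" "1 \<le> e" "d * e \<le> y\<^sup>2"
      by auto
    have div: "e \<le> y\<^sup>2 div d" "d \<le> y\<^sup>2 div e"
      using de by (simp_all add: less_eq_div_iff_mult_less_eq mult.commute)
    have "d \<le> y \<or> e \<le> y"
    proof (rule ccontr)
      assume "\<not> ?thesis"
      then have "Suc y * Suc y \<le> d * e"
        by (intro mult_le_mono) auto
      with de show False
        by (simp add: power2_eq_square)
    qed
    then show "(d, e) \<in> A \<union> B \<union> C"
      using de div by (auto simp: A_def B_def C_def)
  next
    fix d e :: nat
    assume "(d, e) \<in> A \<union> B \<union> C"
    then consider "1 \<le> d" "d \<le> y" "1 \<le> e" "e \<le> y" | "1 \<le> d" "Suc y \<le> e" "e \<le> y\<^sup>2 div d"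
      | "1 \<le> e" "Suc y \<le> d" "d \<le> y\<^sup>2 div e"
      by (auto simp: A_def B_def C_def)
    then show "(d, e) \<in> {(d, e). 1 \<le> d \<and> 1 \<le> e \<and> d * e \<le> y\<^sup>2}"
      by cases (auto simp: less_eq_div_iff_mult_less_eq mult.commute power2_eq_square mult_le_mono)
  qed
  moreover have "finite A" "finite B" "finite C" "A \<inter> B = {}" "(A \<union> B) \<inter> C = {}"
    by (auto simp: A_def B_def C_def)
  ultimately have "(\<Sum>(d, e) | 1 \<le> d \<and> 1 \<le> e \<and> d * e \<le> y\<^sup>2. (f d * w d) * (g e * w e)) =
      sum ?h A + sum ?h B + sum ?h C"
    by (simp add: sum.union_disjoint)
  moreover have "sum ?h A = (\<Sum>d\<in>{1..<Suc y}. f d * w d) * (\<Sum>e\<in>{1..<Suc y}. g e * w e)"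
    unfolding A_def by (simp only: sum_product sum.cartesian_product)
  then have "\<bar>sum ?h A\<bar> \<le> K * K"
    unfolding abs_mult using tail[of 1 f "Suc y", OF _ f(1)] tail[of 1 g "Suc y", OF _ g(1)] K
    by (simp only: abs_mult) (intro mult_mono; simp add: w_def)
  moreover have "sum ?h B =
      (\<Sum>d\<in>{1..<Suc y}. \<Sum>e\<in>{Suc y..<Suc (y\<^sup>2 div d)}. (f d * w d) * (g e * w e))"
    unfolding B_def by (subst sum.Sigma) auto
  then have "\<bar>sum ?h B\<bar> \<le> 2 * K"
    using side[of f g, OF f(2) g(1)] by (simp only:)
  moreover have "sum ?h C =
      (\<Sum>e\<in>{1..<Suc y}. \<Sum>d\<in>{Suc y..<Suc (y\<^sup>2 div e)}. (g e * w e) * (f d * w d))"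
  proof -
    have "sum ?h C = (\<Sum>(e, d)\<in>B. (g e * w e) * (f d * w d))"
      unfolding C_def by (subst sum.reindex) (auto simp: inj_on_def mult.commute intro!: sum.cong)
    also have "\<dots> =
        (\<Sum>e\<in>{1..<Suc y}. \<Sum>d\<in>{Suc y..<Suc (y\<^sup>2 div e)}. (g e * w e) * (f d * w d))"
      unfolding B_def by (subst sum.Sigma) auto
    finally show ?thesis .
  qed
  then have "\<bar>sum ?h C\<bar> \<le> 2 * K"
    using side[of g f, OF g(2) f(1)] by (simp only:)
  moreover have "f d * g e / sqrt (real (d * e)) = (f d * w d) * (g e * w e)" for d e
    by (simp add: w_def real_sqrt_mult)
  ultimately show ?thesis
    by (simp add: power2_eq_square abs_le_iff)
qed


section \<open>Divisor sums of multiplicative functions with values 1, 0 and -1\<close>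

definition divisor_sum :: "(nat \<Rightarrow> real) \<Rightarrow> nat \<Rightarrow> real" where
  "divisor_sum f n = (\<Sum>d | d dvd n. f d)"

text \<open>Every divisor is \<open>p ^ i * d\<close> for exactly one pair with
  \<open>i <= e\<close> and \<open>d dvd m\<close>; \<open>i\<close> is recovered as the
  multiplicity of \<open>p\<close>.\<close>

lemma divisor_sum_prime_power_mult:
  fixes f :: "nat \<Rightarrow> real"
  assumes mult: "\<And>a b. f (a * b) = f a * f b" and one: "f 1 = 1"
    and p: "prime p" "\<not> p dvd m"
  shows "divisor_sum f (p ^ e * m) = (\<Sum>i\<le>e. f p ^ i) * divisor_sum f m"
proof -
  have m: "m \<noteq> 0"
    using p by (metis dvd_0_right)
  have pow: "f (p ^ i) = f p ^ i" for i
    by (induction i) (auto simp: mult one[simplified])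
  have mult_p: "multiplicity p (p ^ i * d) = i" if "d dvd m" for i d
    using that p m by (intro multiplicity_eqI) (auto dest: dvd_trans)
  have "bij_betw (\<lambda>(i, d). p ^ i * d) ({..e} \<times> {d. d dvd m}) {d. d dvd p ^ e * m}"
  proof (rule bij_betw_imageI)
    show "inj_on (\<lambda>(i, d). p ^ i * d) ({..e} \<times> {d. d dvd m})"
    proof (rule inj_onI; clarify)
      fix i d j d'
      assume "p ^ i * d = p ^ j * d'" "d dvd m" "d' dvd m"
      moreover from this have "i = j"
        using mult_p by metis
      ultimately show "i = j \<and> d = d'"
        using p(1) by auto
    qed
    show "(\<lambda>(i, d). p ^ i * d) ` ({..e} \<times> {d. d dvd m}) = {d. d dvd p ^ e * m}"
    proof (intro equalityI subsetI)
      fix x assume "x \<in> {d. d dvd p ^ e * m}"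
      then obtain a d where "x = a * d" "a dvd p ^ e" "d dvd m"
        by (auto elim: dvd_productE)
      moreover from this obtain i where "i \<le> e" "a = p ^ i"
        using divides_primepow_nat[OF p(1)] by blast
      ultimately show "x \<in> (\<lambda>(i, d). p ^ i * d) ` ({..e} \<times> {d. d dvd m})"
        by (auto intro!: image_eqI[of _ _ "(i, d)"])
    qed (auto intro: mult_dvd_mono le_imp_power_dvd)
  qed
  then have "divisor_sum f (p ^ e * m) = (\<Sum>(i, d)\<in>{..e} \<times> {d. d dvd m}. f (p ^ i * d))"
    unfolding divisor_sum_def by (subst sum.reindex_bij_betw[symmetric]) (auto simp: case_prod_unfold)
  also have "\<dots> = (\<Sum>i\<le>e. f p ^ i) * divisor_sum f m"
    by (simp add: mult pow divisor_sum_def sum_product sum.cartesian_product)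
  finally show ?thesis .
qed

lemma split_off_prime_power:
  fixes n p :: nat
  assumes "n > 0" "prime p"
  obtains m where "n = p ^ multiplicity p n * m" "\<not> p dvd m" "m > 0" "p dvd n \<Longrightarrow> m < n"
proof -
  obtain m where m: "n = p ^ multiplicity p n * m" "\<not> p dvd m"
    using multiplicity_decompose'[of n p] assms not_prime_unit by blast
  have "m > 0"
    using m(2) by (cases m) auto
  moreover have "m < n" if "p dvd n"
  proof -
    have "multiplicity p n > 0"
      using that assms by (simp add: prime_multiplicity_gt_zero_iff)
    then have "p ^ multiplicity p n > 1"
      using assms prime_gt_1_nat one_less_power by blast
    with \<open>m > 0\<close> have "m < p ^ multiplicity p n * m"
      by simp
    with m(1) show ?thesis by simp
  qed
  ultimately show thesis
    using m that by blast
qed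

text \<open>These are the local factors of a divisor sum at a prime: \<open>e + 1\<close> for
  \<open>s = 1\<close>, 1 for \<open>s = 0\<close> because \<open>0 ^ 0 = 1\<close>, and 1 or 0
  according to the parity of \<open>e\<close> for \<open>s = - 1\<close>.\<close>

lemma sum_powers_sign:
  fixes s :: real
  assumes "s = 1 \<or> s = 0 \<or> s = - 1"
  shows "(\<Sum>i\<le>e. s ^ i) \<ge> 0" "even e \<Longrightarrow> (\<Sum>i\<le>e. s ^ i) \<ge> 1"
    "odd e \<Longrightarrow> s = - 1 \<Longrightarrow> (\<Sum>i\<le>e. s ^ i) = 0"
proof -
  have neg: "(\<Sum>i\<le>e. (- 1 :: real) ^ i) = (if even e then 1 else 0)"
    by (induction e) auto
  have zero: "(\<Sum>i\<le>e. (0 :: real) ^ i) = 1"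
    by (induction e) auto
  show "(\<Sum>i\<le>e. s ^ i) \<ge> 0" "even e \<Longrightarrow> (\<Sum>i\<le>e. s ^ i) \<ge> 1"
    "odd e \<Longrightarrow> s = - 1 \<Longrightarrow> (\<Sum>i\<le>e. s ^ i) = 0"
    using assms neg zero by auto
qed

context
  fixes f :: "nat \<Rightarrow> real"
  assumes mult: "\<And>a b. f (a * b) = f a * f b" and one: "f 1 = 1"
    and sign: "\<And>n. f n = 1 \<or> f n = 0 \<or> f n = - 1"
begin

lemma divisor_sum_nonneg:
  assumes "n > 0"
  shows "divisor_sum f n \<ge> 0"
  using assms
proof (induction n rule: less_induct)
  case (less n)
  show ?case
  proof (cases "n = 1")
    case True
    then show ?thesis using one by (simp add: divisor_sum_def)
  next
    case False
    then obtain p where p: "prime p" "p dvd n"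
      using prime_factor_nat by blast
    obtain m where m: "n = p ^ multiplicity p n * m" "\<not> p dvd m" "m > 0" "m < n"
      using split_off_prime_power[OF less.prems p(1)] p(2) by metis
    show ?thesis
      using less.IH[OF m(4,3)] sum_powers_sign(1)[OF sign]
      by (subst m(1)) (simp add: divisor_sum_prime_power_mult[OF mult one p(1) m(2)])
  qed
qed

text \<open>All prime exponents in a square are even, so every local factor is at least 1.\<close>

lemma divisor_sum_square:
  assumes "k > 0"
  shows "divisor_sum f (k\<^sup>2) \<ge> 1"
  using assms
proof (induction k rule: less_induct)
  case (less k)
  show ?case
  proof (cases "k = 1")
    case True
    then show ?thesis using one by (simp add: divisor_sum_def)
  next
    case False
    then obtain p where p: "prime p" "p dvd k"
      using prime_factor_nat by blast
    obtain m where m: "k = p ^ multiplicity p k * m" "\<not> p dvd m" "m > 0" "m < k"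
      using split_off_prime_power[OF less.prems p(1)] p(2) by metis
    have "k\<^sup>2 = p ^ (2 * multiplicity p k) * m\<^sup>2"
      by (subst m(1)) (simp add: power_mult_distrib power_mult[symmetric] mult.commute)
    moreover have "\<not> p dvd m\<^sup>2"
      using p m(2) prime_dvd_power by blast
    ultimately have "divisor_sum f (k\<^sup>2) =
        (\<Sum>i\<le>2 * multiplicity p k. f p ^ i) * divisor_sum f (m\<^sup>2)"
      using divisor_sum_prime_power_mult[OF mult one p(1)] by simp
    moreover have "(\<Sum>i\<le>2 * multiplicity p k. f p ^ i) \<ge> 1"
      by (rule sum_powers_sign(2)[OF sign]) simp
    ultimately show ?thesis
      using less.IH[OF m(4,3)] mult_mono[of 1 "\<Sum>i\<le>2 * multiplicity p k. f p ^ i" 1 "divisor_sum f (m\<^sup>2)"]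
      by simp
  qed
qed

lemma divisor_sum_eq_0:
  assumes "n > 0" "prime p" "odd (multiplicity p n)" "f p = - 1"
  shows "divisor_sum f n = 0"
proof -
  obtain m where m: "n = p ^ multiplicity p n * m" "\<not> p dvd m"
    using split_off_prime_power[OF assms(1,2)] by metis
  show ?thesis
    using sum_powers_sign(3)[OF sign assms(3,4)]
    by (subst m(1)) (simp add: divisor_sum_prime_power_mult[OF mult one assms(2) m(2)])
qed

end

section \<open>Integers with prescribed character values\<close>

text \<open>Quadratic characters modulo \<open>M\<close>, stated abstractly. Independence provides a
  class at which one character alone is -1, so every product over a nonempty subset of
  \<open>J\<close> is a nontrivial character.\<close>

locale real_characters =
  fixes M :: nat and J :: "'j set" and \<psi> :: "'j \<Rightarrow> nat \<Rightarrow> real"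
  assumes M_gt_1: "M > 1" and finite_J: "finite J" and J_nonempty: "J \<noteq> {}"
    and mult: "j \<in> J \<Longrightarrow> coprime a M \<Longrightarrow> coprime b M \<Longrightarrow> \<psi> j (a * b) = \<psi> j a * \<psi> j b"
    and periodic: "j \<in> J \<Longrightarrow> \<psi> j (n + M) = \<psi> j n"
    and sign: "j \<in> J \<Longrightarrow> coprime n M \<Longrightarrow> \<psi> j n = 1 \<or> \<psi> j n = - 1"
    and independent: "j \<in> J \<Longrightarrow>
      \<exists>b. coprime b M \<and> \<psi> j b = - 1 \<and> (\<forall>i\<in>J - {j}. \<psi> i b = 1)"
begin

text \<open>Extension by 0 makes the product completely multiplicative on all naturals;
  \<open>\<Psi> {}\<close> is the principal character modulo \<open>M\<close>, not the constant
  1.\<close>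

definition \<Psi> :: "'j set \<Rightarrow> nat \<Rightarrow> real" where
  "\<Psi> T n = (if coprime n M then (\<Prod>j\<in>T. \<psi> j n) else 0)"

lemma char_mult: "T \<subseteq> J \<Longrightarrow> \<Psi> T (a * b) = \<Psi> T a * \<Psi> T b"
  unfolding \<Psi>_def by (auto simp: prod.distrib[symmetric] subset_iff intro!: prod.cong mult)

lemma psi_1: "j \<in> J \<Longrightarrow> \<psi> j 1 = 1"
  using mult[of j 1 1] sign[of j 1] by auto

lemma char_1: "T \<subseteq> J \<Longrightarrow> \<Psi> T 1 = 1"
  using psi_1 by (auto simp: \<Psi>_def subset_iff)

lemma char_sign_coprime:
  assumes "T \<subseteq> J" "coprime n M"
  shows "\<Psi> T n = 1 \<or> \<Psi> T n = - 1"
proof -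
  have "finite T"
    using assms finite_J finite_subset by blast
  then have "(\<Prod>j\<in>T. \<psi> j n) = 1 \<or> (\<Prod>j\<in>T. \<psi> j n) = - 1"
    using assms(1)
  proof (induction T rule: finite_induct)
    case (insert j T)
    then show ?case
      using sign[of j n] assms(2) by auto
  qed simp
  then show ?thesis
    using assms(2) by (simp add: \<Psi>_def)
qed

lemma char_sign:
  assumes "T \<subseteq> J"
  shows "\<Psi> T n = 1 \<or> \<Psi> T n = 0 \<or> \<Psi> T n = - 1"
  using char_sign_coprime[OF assms, of n] by (auto simp: \<Psi>_def)

lemma abs_char_le: "T \<subseteq> J \<Longrightarrow> \<bar>\<Psi> T n\<bar> \<le> 1"
  using char_sign[of T n] by auto

lemma char_periodic:
  assumes "T \<subseteq> J"
  shows "\<Psi> T (n + M) = \<Psi> T n"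
proof -
  have "coprime (n + M) M \<longleftrightarrow> coprime n M"
    unfolding coprime_iff_gcd_eq_1 by simp
  moreover have "(\<Prod>j\<in>T. \<psi> j (n + M)) = (\<Prod>j\<in>T. \<psi> j n)"
    using assms by (intro prod.cong) (auto simp: periodic)
  ultimately show ?thesis
    by (simp add: \<Psi>_def)
qed

lemma char_mod:
  assumes "T \<subseteq> J"
  shows "\<Psi> T (n mod M) = \<Psi> T n"
proof -
  have "\<Psi> T (r + k * M) = \<Psi> T r" for r k
  proof (induction k)
    case (Suc k)
    then show ?case
      using char_periodic[OF assms, of "r + k * M"] by (simp add: ac_simps)
  qed simp
  from this[of "n mod M" "n div M"] show ?thesis
    by simp
qed

text \<open>Multiplication by a class \<open>b\<close> with character value -1 permutes the
  residues, so the sum over them equals its own negative. Sliding the window by one preserves the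
  value by periodicity.\<close>

lemma char_sum_period:
  assumes "T \<subseteq> J" "T \<noteq> {}"
  shows "(\<Sum>n\<in>{a..<a + M}. \<Psi> T n) = 0"
proof -
  obtain j where j: "j \<in> T"
    using assms by blast
  then obtain b where b: "coprime b M" "\<psi> j b = - 1" "\<forall>i\<in>J - {j}. \<psi> i b = 1"
    using independent assms by blast
  have "finite T"
    using assms finite_J finite_subset by blast
  then have "(\<Prod>i\<in>T. \<psi> i b) = \<psi> j b * (\<Prod>i\<in>T - {j}. \<psi> i b)"
    using j by (rule prod.remove)
  also have "(\<Prod>i\<in>T - {j}. \<psi> i b) = 1"
    using b(3) assms(1) by (intro prod.neutral) blast
  finally have chi_b: "\<Psi> T b = - 1"
    using b by (simp add: \<Psi>_def)
  have "inj_on (\<lambda>n. (b * n) mod M) {..<M}"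
  proof (rule inj_onI)
    fix x y
    assume xy: "x \<in> {..<M}" "y \<in> {..<M}" "(b * x) mod M = (b * y) mod M"
    then have "[b * x = b * y] (mod M)"
      by (simp add: unique_euclidean_semiring_class.cong_def)
    then have "[x = y] (mod M)"
      using b(1) cong_mult_lcancel_nat coprime_commute by blast
    with xy show "x = y"
      by (simp add: unique_euclidean_semiring_class.cong_def)
  qed
  moreover have "(\<lambda>n. (b * n) mod M) ` {..<M} \<subseteq> {..<M}"
    using M_gt_1 by auto
  ultimately have "bij_betw (\<lambda>n. (b * n) mod M) {..<M} {..<M}"
    by (simp add: bij_betw_def endo_inj_surj)
  then have "(\<Sum>n<M. \<Psi> T n) = (\<Sum>n<M. \<Psi> T ((b * n) mod M))"
    by (rule sum.reindex_bij_betw[symmetric])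
  also have "\<dots> = - (\<Sum>n<M. \<Psi> T n)"
    by (simp add: char_mod[OF assms(1)] char_mult[OF assms(1)] chi_b sum_negf)
  finally have "(\<Sum>n<M. \<Psi> T n) = 0"
    by simp
  then show ?thesis
  proof (induction a)
    case 0
    then show ?case by (simp add: atLeast0LessThan)
  next
    case (Suc a)
    have "(\<Sum>n\<in>{a..<a + M}. \<Psi> T n) + \<Psi> T (a + M) = (\<Sum>n\<in>{a..<Suc (a + M)}. \<Psi> T n)"
      by simp
    also have "\<dots> = \<Psi> T a + (\<Sum>n\<in>{Suc a..<Suc (a + M)}. \<Psi> T n)"
      by (subst sum.atLeast_Suc_lessThan) auto
    finally show ?case
      using Suc char_periodic[OF assms(1), of a] by simp
  qed
qed

text \<open>Whole periods contribute 0, and fewer than \<open>M\<close> terms remain, each at most 1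
  in absolute value.\<close>

lemma char_sum_bound:
  assumes "T \<subseteq> J" "T \<noteq> {}"
  shows "\<bar>\<Sum>n\<in>{a..<b}. \<Psi> T n\<bar> \<le> real M"
proof (induction "b - a" arbitrary: a rule: less_induct)
  case less
  show ?case
  proof (cases "b < a + M")
    case True
    have "\<bar>\<Sum>n\<in>{a..<b}. \<Psi> T n\<bar> \<le> (\<Sum>n\<in>{a..<b}. 1)"
      using abs_char_le[OF assms(1)] by (intro order_trans[OF sum_abs] sum_mono) auto
    also have "\<dots> \<le> real M"
      using True by simp
    finally show ?thesis .
  next
    case False
    then have "(\<Sum>n\<in>{a..<b}. \<Psi> T n) = (\<Sum>n\<in>{a..<a + M}. \<Psi> T n) + (\<Sum>n\<in>{a + M..<b}. \<Psi> T n)"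
      by (intro sum.atLeastLessThan_concat[symmetric]) auto
    with False less[of "a + M"] M_gt_1 show ?thesis
      by (simp add: char_sum_period[OF assms])
  qed
qed

definition R :: "nat \<Rightarrow> real" where
  "R n = divisor_sum (\<Psi> J) n"

lemma sum_over_divisor_pairs:
  fixes F :: "nat \<Rightarrow> nat \<Rightarrow> real"
  shows "(\<Sum>n = 1..x. \<Sum>d | d dvd n. F (n div d) d) =
    (\<Sum>(d, e) | 1 \<le> d \<and> 1 \<le> e \<and> d * e \<le> x. F d e)"
proof -
  have "(\<Sum>n = 1..x. \<Sum>d | d dvd n. F (n div d) d) =
      (\<Sum>(n, d)\<in>(SIGMA n:{1..x}. {d. d dvd n}). F (n div d) d)"
    by (rule sum.Sigma) auto
  also have "\<dots> = (\<Sum>(d, e) | 1 \<le> d \<and> 1 \<le> e \<and> d * e \<le> x. F d e)"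
    by (rule sum.reindex_bij_witness[of _ "\<lambda>(d, e). (d * e, e)" "\<lambda>(n, d). (n div d, d)"])
      (auto elim!: dvdE simp: mult.commute)
  finally show ?thesis .
qed

text \<open>On arguments coprime to \<open>M\<close> the signs square to 1, so the twist of
  \<open>\<Psi> J\<close> by \<open>\<Psi> T\<close> is \<open>\<Psi> (J - T)\<close>. This gives a
  Dirichlet convolution, both factors of which are nontrivial characters when \<open>T\<close> is
  neither empty nor \<open>J\<close>.\<close>

lemma char_mult_R:
  assumes "T \<subseteq> J" "n > 0"
  shows "\<Psi> T n * R n = (\<Sum>d | d dvd n. \<Psi> T (n div d) * \<Psi> (J - T) d)"
proof -
  have "\<Psi> T n * \<Psi> J d = \<Psi> T (n div d) * \<Psi> (J - T) d" if "d dvd n" for d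
  proof -
    have "\<Psi> T n = \<Psi> T (n div d) * \<Psi> T d"
      using that char_mult[OF assms(1), of "n div d" d] by simp
    moreover have "\<Psi> T d * \<Psi> J d = \<Psi> (J - T) d"
    proof (cases "coprime d M")
      case True
      have "\<Psi> J d = \<Psi> (J - T) d * \<Psi> T d"
        using True assms(1) finite_J by (simp add: \<Psi>_def prod.subset_diff)
      then show ?thesis
        using char_sign_coprime[OF assms(1) True] by auto
    qed (simp add: \<Psi>_def)
    ultimately show ?thesis
      by (simp add: mult.assoc)
  qed
  then show ?thesis
    unfolding R_def divisor_sum_def sum_distrib_left by (intro sum.cong) auto
qed

lemma R_nonneg: "n > 0 \<Longrightarrow> R n \<ge> 0"
  unfolding R_def using char_mult char_1 char_sign by (intro divisor_sum_nonneg) auto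

lemma R_square: "k > 0 \<Longrightarrow> R (k\<^sup>2) \<ge> 1"
  unfolding R_def using char_mult char_1 char_sign by (intro divisor_sum_square) auto

lemma R_eq_0: "n > 0 \<Longrightarrow> prime p \<Longrightarrow> odd (multiplicity p n) \<Longrightarrow> \<Psi> J p = - 1 \<Longrightarrow> R n = 0"
  unfolding R_def using char_mult char_1 char_sign by (intro divisor_sum_eq_0[of _ n p]) auto

text \<open>The involution \<open>d -> n div d\<close> exchanges the two convolution factors. Hence
  the terms for \<open>J\<close> and the empty set reinforce each other when the prescribed signs
  have product 1.\<close>

lemma char_J_mult_R:
  assumes "n > 0"
  shows "\<Psi> J n * R n = \<Psi> {} n * R n"
proof -
  have "\<Psi> J n * R n = (\<Sum>d | d dvd n. \<Psi> J (n div d) * \<Psi> {} d)"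
    using char_mult_R[of J n] assms by simp
  also have "\<dots> = (\<Sum>d | d dvd n. \<Psi> {} (n div d) * \<Psi> J d)"
    using assms by (intro sum.reindex_bij_witness[of _ "\<lambda>d. n div d" "\<lambda>d. n div d"])
      (auto elim!: dvdE)
  also have "\<dots> = \<Psi> {} n * R n"
    using char_mult_R[of "{}" n] assms by simp
  finally show ?thesis .
qed

lemma char_R_sum_bound:
  assumes "T \<subseteq> J" "T \<noteq> {}" "T \<noteq> J"
  shows "\<bar>\<Sum>n = 1..y\<^sup>2. \<Psi> T n * R n / sqrt (real n)\<bar> \<le> (real M)\<^sup>2 + 4 * real M"
proof -
  have "(\<Sum>n = 1..y\<^sup>2. \<Psi> T n * R n / sqrt (real n)) =
      (\<Sum>n = 1..y\<^sup>2. \<Sum>d | d dvd n. \<Psi> T (n div d) * \<Psi> (J - T) d / sqrt (real (n div d * d)))"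
    by (intro sum.cong) (auto simp: char_mult_R[OF assms(1)] sum_divide_distrib intro!: sum.cong)
  also have "\<dots> = (\<Sum>(d, e) | 1 \<le> d \<and> 1 \<le> e \<and> d * e \<le> y\<^sup>2.
      \<Psi> T d * \<Psi> (J - T) e / sqrt (real (d * e)))"
    by (rule sum_over_divisor_pairs)
  also have "\<bar>\<dots>\<bar> \<le> (real M)\<^sup>2 + 4 * real M"
    using assms by (intro hyperbola_sum_bound char_sum_bound abs_char_le) auto
  finally show ?thesis .
qed

text \<open>Only the squares of the numbers \<open>i * M + 1\<close> with \<open>i < m\<close> are
  kept. There \<open>R\<close> is at least 1 and the term at least \<open>1 / ((i + 1) * M)\<close>;
  all other terms are nonnegative.\<close>

lemma R_sum_lower_bound:
  assumes "y = m * M + 1"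
  shows "harm m / real M \<le> (\<Sum>n = 1..y\<^sup>2. \<Psi> {} n * R n / sqrt (real n))"
proof -
  let ?s = "\<lambda>i. (i * M + 1)\<^sup>2"
  have cop: "coprime (?s i) M" for i
    by (metis coprime_1_left coprime_iff_gcd_eq_1 coprime_power_left_iff gcd_add_mult mult.commute
        add.commute gcd.commute)
  have "harm m / real M = (\<Sum>i\<in>{1..m}. 1 / (real i * real M))"
    by (simp add: harm_def sum_divide_distrib field_simps)
  also have "\<dots> = (\<Sum>i<m. 1 / (real (Suc i) * real M))"
    by (rule sum.reindex_bij_witness[of _ Suc "\<lambda>i. i - 1"]) auto
  also have "\<dots> \<le> (\<Sum>i<m. \<Psi> {} (?s i) * R (?s i) / sqrt (real (?s i)))"
  proof (rule sum_mono)
    fix i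
    have "i * M + 1 \<le> Suc i * M"
      using M_gt_1 by simp
    then have "real (i * M + 1) \<le> real (Suc i) * real M"
      by (metis of_nat_le_iff of_nat_mult)
    then have "1 / (real (Suc i) * real M) \<le> 1 / real (i * M + 1)"
      by (intro frac_le) (auto simp del: of_nat_add of_nat_mult)
    also have "\<dots> \<le> R (?s i) / real (i * M + 1)"
      using R_square[of "i * M + 1"] by (intro divide_right_mono) auto
    also have "\<dots> = \<Psi> {} (?s i) * R (?s i) / sqrt (real (?s i))"
      using cop[of i] by (simp add: \<Psi>_def)
    finally show "1 / (real (Suc i) * real M) \<le> \<Psi> {} (?s i) * R (?s i) / sqrt (real (?s i))" .
  qed
  also have "\<dots> = (\<Sum>n\<in>?s ` {..<m}. \<Psi> {} n * R n / sqrt (real n))"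
    using M_gt_1 by (subst sum.reindex) (auto simp: inj_on_def power2_eq_iff)
  also have "\<dots> \<le> (\<Sum>n = 1..y\<^sup>2. \<Psi> {} n * R n / sqrt (real n))"
  proof (rule sum_mono2)
    show "?s ` {..<m} \<subseteq> {1..y\<^sup>2}"
      using assms by (auto intro!: power_mono)
  qed (auto simp: \<Psi>_def intro!: divide_nonneg_nonneg R_nonneg)
  finally show ?thesis .
qed

theorem exists_prescribed_signs:
  fixes \<epsilon> :: "'j \<Rightarrow> real"
  assumes eps: "\<And>j. j \<in> J \<Longrightarrow> \<epsilon> j = 1 \<or> \<epsilon> j = - 1" and prod_eps: "(\<Prod>j\<in>J. \<epsilon> j) = 1"
  shows "\<exists>n>0. coprime n M \<and> (\<forall>j\<in>J. \<psi> j n = \<epsilon> j) \<and> R n \<noteq> 0"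
proof (rule ccontr)
  assume contra: "\<not> ?thesis"
  then have contra': "\<exists>j\<in>J. \<psi> j n \<noteq> \<epsilon> j" if "n > 0" "coprime n M" "R n \<noteq> 0" for n
    using that by blast
  define B where "B = (real M)\<^sup>2 + 4 * real M"
  define S where "S = (\<lambda>T y. \<Sum>n = 1..y\<^sup>2. \<Psi> T n * R n / sqrt (real n))"
  have eps_T: "\<bar>\<Prod>j\<in>T. \<epsilon> j\<bar> = 1" if "T \<subseteq> J" for T
    unfolding abs_prod
  proof (intro prod.neutral ballI)
    fix j assume "j \<in> T"
    with that have "j \<in> J" by blast
    from eps[OF this] show "\<bar>\<epsilon> j\<bar> = 1" by auto
  qed
  have upper: "S {} y * 2 \<le> real (card (Pow J)) * B" for y
  proof -
    \<comment> \<open>For \<open>n\<close> coprime to \<open>M\<close>, a factor vanishes as soon as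
      one sign differs from the prescribed one, which the assumption guarantees whenever
      \<open>R n \<noteq> 0\<close>. Expanding the product over subsets then brings in the
      characters \<open>\<Psi> T\<close>.\<close>
    have zero: "\<Psi> {} n * (\<Prod>j\<in>J. \<epsilon> j * \<psi> j n + 1) * R n = 0" if n: "n \<in> {1..y\<^sup>2}" for n
    proof (cases "coprime n M \<and> R n \<noteq> 0")
      case True
      then obtain j where j: "j \<in> J" "\<psi> j n \<noteq> \<epsilon> j"
        using contra'[of n] n by auto
      then have "\<epsilon> j * \<psi> j n + 1 = 0"
        using eps[of j] sign[of j n] True by auto
      then have "(\<Prod>j\<in>J. \<epsilon> j * \<psi> j n + 1) = 0"
        using finite_J j(1) by (metis prod_zero_iff)
      then show ?thesis by simp
    qed (auto simp: \<Psi>_def)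
    have expand: "\<Psi> {} n * (\<Prod>j\<in>J. \<epsilon> j * \<psi> j n + 1) = (\<Sum>T\<in>Pow J. (\<Prod>j\<in>T. \<epsilon> j) * \<Psi> T n)" for n
      by (simp add: prod_add[OF finite_J] \<Psi>_def prod.distrib)
    have "(\<Sum>T\<in>Pow J. (\<Prod>j\<in>T. \<epsilon> j) * S T y) =
        (\<Sum>n = 1..y\<^sup>2. \<Sum>T\<in>Pow J. (\<Prod>j\<in>T. \<epsilon> j) * (\<Psi> T n * R n / sqrt (real n)))"
      unfolding S_def sum_distrib_left by (rule sum.swap)
    also have "\<dots> = (\<Sum>n = 1..y\<^sup>2. \<Psi> {} n * (\<Prod>j\<in>J. \<epsilon> j * \<psi> j n + 1) * R n / sqrt (real n))"
      unfolding expand sum_distrib_right sum_divide_distrib by (simp add: mult.assoc)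
    also have "\<dots> = 0"
      using zero by (intro sum.neutral) auto
    finally have "0 = (\<Sum>T\<in>Pow J. (\<Prod>j\<in>T. \<epsilon> j) * S T y)" ..
    also have "\<dots> = S {} y + S J y + (\<Sum>T\<in>Pow J - {{}, J}. (\<Prod>j\<in>T. \<epsilon> j) * S T y)"
    proof -
      have "Pow J = {{}, J} \<union> (Pow J - {{}, J})" by auto
      then have "(\<Sum>T\<in>Pow J. (\<Prod>j\<in>T. \<epsilon> j) * S T y) = (\<Sum>T\<in>{{}, J}. (\<Prod>j\<in>T. \<epsilon> j) * S T y)
          + (\<Sum>T\<in>Pow J - {{}, J}. (\<Prod>j\<in>T. \<epsilon> j) * S T y)"
        using finite_J by (subst sum.union_disjoint[symmetric]) auto
      then show ?thesis
        using J_nonempty prod_eps by simp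
    qed
    also have "S J y = S {} y"
      unfolding S_def by (intro sum.cong) (simp_all add: char_J_mult_R)
    finally have "S {} y * 2 = - (\<Sum>T\<in>Pow J - {{}, J}. (\<Prod>j\<in>T. \<epsilon> j) * S T y)"
      by simp
    also have "\<dots> \<le> \<bar>\<Sum>T\<in>Pow J - {{}, J}. (\<Prod>j\<in>T. \<epsilon> j) * S T y\<bar>"
      by (rule abs_ge_minus_self)
    also have "\<dots> \<le> (\<Sum>T\<in>Pow J - {{}, J}. \<bar>(\<Prod>j\<in>T. \<epsilon> j) * S T y\<bar>)"
      by (rule sum_abs)
    also have "\<dots> \<le> (\<Sum>T\<in>Pow J - {{}, J}. B)"
      using eps_T char_R_sum_bound by (intro sum_mono) (auto simp: abs_mult B_def S_def)
    also have "\<dots> \<le> real (card (Pow J)) * B"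
      using finite_J by (auto simp: B_def intro!: mult_right_mono card_mono)
    finally show ?thesis .
  qed
  obtain m where "harm m > real (card (Pow J)) * B * real M"
  proof -
    have "eventually (\<lambda>m. (harm m :: real) > real (card (Pow J)) * B * real M) sequentially"
      using harm_at_top unfolding filterlim_at_top_dense by simp
    then have "\<exists>m. harm m > real (card (Pow J)) * B * real M"
      by (rule eventually_happens'[OF sequentially_bot])
    then show thesis
      using that by blast
  qed
  moreover have nonneg: "S {} (m * M + 1) \<ge> 0"
    unfolding S_def by (intro sum_nonneg) (auto simp: \<Psi>_def R_nonneg)
  moreover have "harm m / real M \<le> S {} (m * M + 1)"
    unfolding S_def by (rule R_sum_lower_bound) simp
  then have "harm m \<le> S {} (m * M + 1) * real M"
    using M_gt_1 by (simp add: divide_le_eq)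
  ultimately have "real (card (Pow J)) * B * real M < S {} (m * M + 1) * real M"
    by linarith
  then have "real (card (Pow J)) * B < S {} (m * M + 1)"
    by (rule mult_right_less_imp_less) simp
  with upper[of "m * M + 1"] nonneg show False
    by linarith
qed

end

section \<open>Quadratic residues\<close>

lemma Legendre_sign: "Legendre a p = 1 \<or> Legendre a p = 0 \<or> Legendre a p = - 1"
  by (auto simp: Legendre_def)

text \<open>Both sides lie between -1 and 1, so they differ by at most 2, which is less than
  \<open>p\<close>.\<close>

lemma Legendre_eqI:
  assumes "prime p" "2 < p" "[Legendre a (int p) = s] (mod int p)" "s = 1 \<or> s = 0 \<or> s = - 1"
  shows "Legendre a (int p) = s"
proof -
  have "int p dvd Legendre a (int p) - s"
    using assms(3) by (simp add: cong_iff_dvd_diff)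
  moreover have "\<bar>Legendre a (int p) - s\<bar> < int p"
    using Legendre_sign[of a "int p"] assms(2,4) by auto
  ultimately have "Legendre a (int p) - s = 0"
    using dvd_imp_le_int[of "Legendre a (int p) - s" "int p"] by linarith
  then show ?thesis
    by simp
qed

lemma Legendre_mult:
  assumes "prime p" "2 < p"
  shows "Legendre (a * b) (int p) = Legendre a (int p) * Legendre b (int p)"
proof (rule Legendre_eqI[OF assms])
  have "[Legendre (a * b) (int p) = a ^ ((p - 1) div 2) * b ^ ((p - 1) div 2)] (mod int p)"
    using euler_criterion[OF assms, of "a * b"] by (simp add: power_mult_distrib)
  moreover have "[Legendre a (int p) * Legendre b (int p) =
      a ^ ((p - 1) div 2) * b ^ ((p - 1) div 2)] (mod int p)"
    by (intro cong_mult euler_criterion assms)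
  ultimately show "[Legendre (a * b) (int p) = Legendre a (int p) * Legendre b (int p)] (mod int p)"
    using cong_sym cong_trans by blast
qed (use Legendre_sign[of a "int p"] Legendre_sign[of b "int p"] in auto)

lemma Legendre_cong:
  assumes "[a = b] (mod p)"
  shows "Legendre a p = Legendre b p"
proof -
  have "[a = 0] (mod p) \<longleftrightarrow> [b = 0] (mod p)" "QuadRes p a \<longleftrightarrow> QuadRes p b"
    using assms unfolding QuadRes_def by (meson cong_sym cong_trans)+
  then show ?thesis
    by (simp add: Legendre_def)
qed

lemma Legendre_1: "1 < p \<Longrightarrow> Legendre 1 p = 1"
  by (auto simp: Legendre_def QuadRes_def cong_0_iff intro!: exI[of _ 1])

lemma Legendre_eq_0_iff: "Legendre a p = 0 \<longleftrightarrow> p dvd a"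
  by (auto simp: Legendre_def cong_0_iff)

lemma Legendre_minus_1:
  assumes "prime p" "2 < p"
  shows "Legendre (- 1) (int p) = (- 1) ^ ((p - 1) div 2)"
  by (rule Legendre_eqI[OF assms euler_criterion[OF assms]])
    (metis neg_one_even_power neg_one_odd_power)

text \<open>Gauss's lemma: the doubles of \<open>1, ..., (p - 1) / 2\<close> are already reduced
  modulo \<open>p\<close>, and the double of \<open>x\<close> exceeds \<open>(p - 1) / 2\<close>
  exactly if \<open>x > (p - 1) / 4\<close>. The parity of the number of such \<open>x\<close>
  depends on \<open>p mod 8\<close>.\<close>

lemma Legendre_2:
  assumes "prime p" "2 < p"
  shows "Legendre 2 (int p) = (if p mod 8 = 1 \<or> p mod 8 = 7 then 1 else - 1)"
proof -
  have odd: "odd p"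
    using assms prime_odd_nat by blast
  have "\<not> int p dvd 2"
    using assms(2) zdvd_imp_le[of "int p" 2] by auto
  then interpret G: GAUSS p 2
    by unfold_locales (use assms in \<open>auto simp: cong_0_iff\<close>)
  have half: "(int p - 1) div 2 * 2 = int p - 1"
    using odd by simp
  have "G.C = (\<lambda>x. x * 2) ` G.A"
    unfolding G.C_def G.B_def image_image using half
    by (intro image_cong) (auto simp: G.A_def)
  then have "G.E = (\<lambda>x. x * 2) ` {(int p - 1) div 4<..(int p - 1) div 2}"
    unfolding G.E_def G.A_def by auto
  then have "card G.E = card {(int p - 1) div 4<..(int p - 1) div 2}"
    by (simp add: card_image inj_on_def)
  then have card: "card G.E = nat ((int p - 1) div 2 - (int p - 1) div 4)"
    by simp
  define k where "k = p div 8"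
  have p: "p = 8 * k + p mod 8"
    by (simp add: k_def)
  have "p mod 8 = 1 \<or> p mod 8 = 3 \<or> p mod 8 = 5 \<or> p mod 8 = 7"
    using odd by presburger
  then consider "p = 8 * k + 1" | "p = 8 * k + 3" | "p = 8 * k + 5" | "p = 8 * k + 7"
    using p by metis
  then have "even (nat ((int p - 1) div 2 - (int p - 1) div 4)) \<longleftrightarrow> p mod 8 = 1 \<or> p mod 8 = 7"
  proof cases
    case 1
    then have "(int p - 1) div 2 = 4 * int k" "(int p - 1) div 4 = 2 * int k" by simp_all
    with 1 show ?thesis by (simp add: even_nat_iff)
  next
    case 2
    then have "(int p - 1) div 2 = 4 * int k + 1" "(int p - 1) div 4 = 2 * int k" by simp_all
    with 2 show ?thesis by (simp add: even_nat_iff)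
  next
    case 3
    then have "(int p - 1) div 2 = 4 * int k + 2" "(int p - 1) div 4 = 2 * int k + 1" by simp_all
    with 3 show ?thesis by (simp add: even_nat_iff)
  next
    case 4
    then have "(int p - 1) div 2 = 4 * int k + 3" "(int p - 1) div 4 = 2 * int k + 1" by simp_all
    with 4 show ?thesis by (simp add: even_nat_iff)
  qed
  then show ?thesis
    using G.gauss_lemma card by auto
qed

text \<open>If every nonzero class were a square, squaring would be onto and hence injective on the
  nonzero residues, although 1 and \<open>p - 1\<close> have the same square.\<close>

lemma exists_nonresidue:
  assumes "prime p" "2 < p"
  shows "\<exists>a :: nat. Legendre (int a) (int p) = - 1"
proof (rule ccontr)
  assume contra: "\<not> ?thesis"
  let ?f = "\<lambda>x. x\<^sup>2 mod int p"
  have "{1..<int p} \<subseteq> ?f ` {1..<int p}"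
  proof
    fix a assume a: "a \<in> {1..<int p}"
    then have "\<not> int p dvd a"
      using zdvd_not_zless by auto
    moreover have "Legendre a (int p) \<noteq> - 1"
      using contra a by (metis atLeastLessThan_iff int_nat_eq nonneg_int_cases zero_le_one order_trans)
    ultimately have "QuadRes (int p) a"
      by (auto simp: Legendre_def cong_0_iff split: if_splits)
    then obtain y where y: "[y\<^sup>2 = a] (mod int p)"
      by (auto simp: QuadRes_def)
    have "y\<^sup>2 mod int p = a"
      using y a by (simp add: unique_euclidean_semiring_class.cong_def)
    then have fy: "?f (y mod int p) = a"
      by (simp add: power_mod)
    have "y mod int p \<noteq> 0"
    proof
      assume "y mod int p = 0"
      with fy a show False by simp
    qed
    moreover have "0 \<le> y mod int p" "y mod int p < int p"
      using assms(2) by simp_all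
    ultimately have "y mod int p \<in> {1..<int p}"
      by simp
    with fy show "a \<in> ?f ` {1..<int p}"
      by blast
  qed
  then have "card {1..<int p} \<le> card (?f ` {1..<int p})"
    by (intro card_mono) auto
  then have "inj_on ?f {1..<int p}"
    using card_image_le[of "{1..<int p}" ?f] by (intro eq_card_imp_inj_on antisym) simp_all
  moreover have "?f 1 = ?f (int p - 1)"
  proof -
    have "(int p - 1)\<^sup>2 = 1 + (int p - 2) * int p"
      by (simp add: power2_eq_square algebra_simps)
    then show ?thesis
      by simp
  qed
  moreover have "1 \<in> {1..<int p}" "int p - 1 \<in> {1..<int p}"
    using assms(2) by simp_all
  ultimately have "1 = int p - 1"
    by (rule inj_onD)
  with assms(2) show False
    by simp
qed

text \<open>For odd \<open>n\<close> and \<open>D\<close> equal to 1 or 2 this is the Kronecker symbol \<open>(- D / n)\<close>.\<close>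

definition neg_kronecker :: "nat \<Rightarrow> nat \<Rightarrow> int" where
  "neg_kronecker D n = (if n mod 8 = 1 \<or> n mod 8 = (if D = 1 then 5 else 3) then 1 else - 1)"

lemma odd_mod_8: "odd n \<Longrightarrow> n mod 8 = 1 \<or> n mod 8 = 3 \<or> n mod 8 = 5 \<or> n mod 8 = (7 :: nat)"
  by presburger

lemma sigma_mult:
  assumes "odd a" "odd b"
  shows "neg_kronecker D (a * b) = neg_kronecker D a * neg_kronecker D b"
proof -
  have "(a * b) mod 8 = (a mod 8) * (b mod 8) mod 8"
    by (simp add: mod_mult_eq)
  then show ?thesis
    using odd_mod_8[OF assms(1)] odd_mod_8[OF assms(2)]
    by (elim disjE) (simp_all add: neg_kronecker_def)
qed

lemma sigma_sign: "neg_kronecker D n = 1 \<or> neg_kronecker D n = - 1"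
  by (simp add: neg_kronecker_def)

lemma sigma_prod:
  assumes "finite P" "\<And>p. p \<in> P \<Longrightarrow> odd p"
  shows "(\<Prod>p\<in>P. neg_kronecker D p) = neg_kronecker D (\<Prod>P)"
proof -
  have "(\<Prod>p\<in>P. neg_kronecker D p) = neg_kronecker D (\<Prod>P) \<and> odd (\<Prod>P)"
    using assms
  proof (induction P rule: finite_induct)
    case (insert p P)
    then show ?case
      by (auto simp: sigma_mult)
  qed (simp add: neg_kronecker_def)
  then show ?thesis ..
qed

lemma sigma_1_eq_power:
  assumes "odd p"
  shows "neg_kronecker 1 p = (- 1) ^ ((p - 1) div 2)"
proof -
  define k where "k = p div 8"
  have "p = 8 * k + p mod 8"
    by (simp add: k_def)
  then consider "p = 8 * k + 1" | "p = 8 * k + 3" | "p = 8 * k + 5" | "p = 8 * k + 7"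
    using odd_mod_8[OF assms] by metis
  then show ?thesis
    by cases (simp_all add: neg_kronecker_def)
qed

lemma Legendre_minus_sigma:
  assumes "prime p" "2 < p" "D = 1 \<or> D = 2"
  shows "Legendre (- int D) (int p) = neg_kronecker D p"
proof -
  have odd: "odd p"
    using assms prime_odd_nat by blast
  have 1: "Legendre (- 1) (int p) = neg_kronecker 1 p"
    using Legendre_minus_1[OF assms(1,2)] sigma_1_eq_power[OF odd] by simp
  show ?thesis
  proof (cases "D = 1")
    case False
    have "Legendre (- 2) (int p) = Legendre (- 1) (int p) * Legendre 2 (int p)"
      using Legendre_mult[OF assms(1,2), of "- 1" 2] by simp
    also have "\<dots> = neg_kronecker 2 p"
      unfolding 1 Legendre_2[OF assms(1,2)] using odd_mod_8[OF odd] by (auto simp: neg_kronecker_def)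
    finally show ?thesis
      using False assms(3) by simp
  qed (use 1 in simp)
qed

lemma squarefree_imp_coprime_prime:
  fixes p k :: nat
  assumes "squarefree (p * k)" "prime p"
  shows "coprime p k"
proof (rule prime_imp_coprime[OF assms(2)], rule notI)
  assume "p dvd k"
  then have "p\<^sup>2 dvd p * k"
    unfolding power2_eq_square by (rule mult_dvd_mono[OF dvd_refl])
  with assms show False
    using squarefreeD not_prime_unit by blast
qed

text \<open>Chinese remaindering, one prime at a time. The two coefficients cover both congruences
  needed later: \<open>q * t^2 + 1\<close> modulo \<open>D * m\<close> and
  \<open>r^2 + D * m\<close> modulo \<open>q\<close>.\<close>

lemma squarefree_quadratic_congruence:
  fixes m :: nat and \<alpha> \<beta> :: int
  assumes "squarefree m" "\<And>p. prime p \<Longrightarrow> p dvd m \<Longrightarrow> \<exists>t. int p dvd \<alpha> * t\<^sup>2 + \<beta>"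
  shows "\<exists>t. int m dvd \<alpha> * t\<^sup>2 + \<beta>"
  using assms
proof (induction m rule: less_induct)
  case (less m)
  have m: "m > 0"
    using less.prems(1) by (metis gr0I not_squarefree_0)
  show ?case
  proof (cases "m = 1")
    case False
    then obtain p where p: "prime p" "p dvd m"
      using prime_factor_nat by blast
    then obtain k where k: "m = p * k"
      by (elim dvdE)
    have cop: "coprime p k"
      using squarefree_imp_coprime_prime less.prems(1) p(1) unfolding k by blast
    have "k < m"
      using m k prime_gt_1_nat[OF p(1)] by simp
    moreover have "squarefree k"
      using less.prems(1) k by (metis dvd_triv_right squarefree_mono)
    ultimately obtain t where t: "int k dvd \<alpha> * t\<^sup>2 + \<beta>"
      using less.IH[of k] less.prems(2) k by auto
    obtain s where s: "int p dvd \<alpha> * s\<^sup>2 + \<beta>"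
      using less.prems(2) p by blast
    obtain x where x: "[x = s] (mod int p)" "[x = t] (mod int k)"
      using binary_chinese_remainder_int[of "int p" "int k" s t] cop by auto
    have "[\<alpha> * x\<^sup>2 + \<beta> = \<alpha> * s\<^sup>2 + \<beta>] (mod int p)" "[\<alpha> * x\<^sup>2 + \<beta> = \<alpha> * t\<^sup>2 + \<beta>] (mod int k)"
      by (intro cong_add cong_mult cong_pow cong_refl x)+
    then have "int p dvd \<alpha> * x\<^sup>2 + \<beta>" "int k dvd \<alpha> * x\<^sup>2 + \<beta>"
      using s t cong_dvd_iff by blast+
    then have "int p * int k dvd \<alpha> * x\<^sup>2 + \<beta>"
      using cop by (intro divides_mult) auto
    then show ?thesis
      using k by auto
  qed simp
qed

section \<open>Sums of three squares\<close>

lemma coprime_8_iff: "coprime (8 :: nat) a \<longleftrightarrow> odd a"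
  using coprime_power_left_iff[of 2 3 a] by simp

text \<open>The index 2 stands for the character modulo 8, an odd prime index for the Legendre symbol.\<close>

definition quad_char :: "nat \<Rightarrow> nat \<Rightarrow> nat \<Rightarrow> real" where
  "quad_char D j n = real_of_int (if j = 2 then neg_kronecker D n else Legendre (int n) (int j))"

locale squarefree_modulus =
  fixes m D :: nat
  assumes m: "squarefree m" "m mod 4 = 1" and D: "D = 1 \<or> D = 2"
begin

definition P :: "nat set" where
  "P = prime_factors m"

lemma odd_m: "odd m"
  using m(2) by presburger

lemma m_pos: "m > 0"
  using odd_m by (cases m) auto

lemma P:
  assumes "p \<in> P"
  shows "prime p" "2 < p" "odd p" "p dvd m"
proof -
  show p: "prime p" "p dvd m"
    using assms by (auto simp: P_def)
  then show "odd p"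
    using odd_m dvd_trans by blast
  then show "2 < p"
    using prime_ge_2_nat[OF p(1)] by (cases "p = 2") auto
qed

lemma finite_P: "finite P"
  by (simp add: P_def)

lemma two_P: "2 \<notin> P"
  using P(2) by blast

lemma prod_P: "\<Prod>P = m"
proof -
  have "\<forall>p\<in>prime_factors m. multiplicity p m = 1"
    using m(1) m_pos by (simp add: squarefree_factorial_semiring')
  then have "(\<Prod>p\<in>prime_factors m. p ^ multiplicity p m) = \<Prod>P"
    unfolding P_def by (intro prod.cong) auto
  then show ?thesis
    using prod_prime_factors[of m] m_pos by simp
qed

text \<open>By multiplicativity this is \<open>(- 1 / m)\<close>, and \<open>m mod 4 = 1\<close>. It
  is used twice: the signs from quadratic reciprocity cancel, and the prescribed signs have product
  1.\<close>

lemma sigma_P: "(\<Prod>p\<in>P. neg_kronecker 1 p) = 1"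
proof -
  have "(\<Prod>p\<in>P. neg_kronecker 1 p) = neg_kronecker 1 m"
    using sigma_prod[OF finite_P] P(3) prod_P by simp
  moreover have "m mod 8 = 1 \<or> m mod 8 = 5"
    using m(2) by presburger
  ultimately show ?thesis
    by (auto simp: neg_kronecker_def)
qed

lemma coprime_M:
  assumes "coprime n (8 * m)"
  shows "odd n" "p \<in> P \<Longrightarrow> \<not> p dvd n"
proof -
  have "coprime n 2" and nm: "coprime n m"
    by (rule coprime_divisors[OF dvd_refl _ assms]; simp)+
  then show "odd n"
    by simp
  show "\<not> p dvd n" if "p \<in> P"
    using coprime_common_divisor[OF nm, of p] P(1,4)[OF that] not_prime_unit by blast
qed

lemma real_characters_quad_char: "real_characters (8 * m) (insert 2 P) (quad_char D)"
proof
  show "1 < 8 * m" "finite (insert 2 P)" "insert 2 P \<noteq> {}"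
    using m_pos finite_P by auto
  next
    fix j a b
    assume "j \<in> insert 2 P" "coprime a (8 * m)" "coprime b (8 * m)"
    then show "quad_char D j (a * b) = quad_char D j a * quad_char D j b"
      using coprime_M[of a] coprime_M[of b] Legendre_mult[OF P(1,2)] sigma_mult
      by (auto simp: quad_char_def)
  next
    fix j n
    assume j: "j \<in> insert 2 P"
    have "neg_kronecker D (n + 8 * m) = neg_kronecker D n"
      by (simp add: neg_kronecker_def)
    moreover have "Legendre (int (n + 8 * m)) (int j) = Legendre (int n) (int j)" if "j \<in> P"
    proof (rule Legendre_cong)
      have "int j dvd int (8 * m)"
        using P(4)[OF that] by auto
      then show "[int (n + 8 * m) = int n] (mod int j)"
        by (simp add: cong_iff_dvd_diff)
    qed
    ultimately show "quad_char D j (n + 8 * m) = quad_char D j n"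
      using j by (auto simp: quad_char_def)
  next
    fix j n
    assume j: "j \<in> insert 2 P" and n: "coprime n (8 * m)"
    have "Legendre (int n) (int j) \<noteq> 0" if "j \<in> P"
      using coprime_M[OF n] that by (simp add: Legendre_eq_0_iff)
    then show "quad_char D j n = 1 \<or> quad_char D j n = - 1"
      using j sigma_sign[of D n] Legendre_sign[of "int n" "int j"] by (auto simp: quad_char_def)
  next
    fix j
    assume "j \<in> insert 2 P"
    then consider "j = 2" | "j \<in> P" "j \<noteq> 2"
      using two_P by auto
    then show "\<exists>b. coprime b (8 * m) \<and> quad_char D j b = - 1 \<and> (\<forall>i\<in>insert 2 P - {j}. quad_char D i b = 1)"
    proof cases
      case 1
      have "coprime 8 m"
        using odd_m coprime_8_iff by simp
      \<comment> \<open>The class 7 modulo 8 has \<open>neg_kronecker\<close> value -1 for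
        \<open>D = 1\<close> and for \<open>D = 2\<close>.\<close>
      then obtain b where b: "[b = 7] (mod 8)" "[b = 1] (mod m)"
        using binary_chinese_remainder_nat by blast
      have "neg_kronecker D b = - 1"
        using b(1) by (simp add: neg_kronecker_def unique_euclidean_semiring_class.cong_def)
      moreover have "Legendre (int b) (int i) = 1" if "i \<in> P" for i
      proof -
        have "[b = 1] (mod i)"
          using b(2) P(4)[OF that] cong_dvd_modulus_nat by blast
        then have "[int b = 1] (mod int i)"
          by (metis cong_int_iff of_nat_1)
        then show ?thesis
          using Legendre_cong Legendre_1[of "int i"] P(2)[OF that] by force
      qed
      moreover have "coprime b (8 * m)"
      proof -
        have "b mod 8 = 7"
          using b(1) by (simp add: unique_euclidean_semiring_class.cong_def)
        then have "odd b"
          by presburger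
        then have "coprime b 8"
          using coprime_8_iff coprime_commute by blast
        moreover have "coprime b m"
          using b(2) by (metis cong_imp_coprime cong_sym coprime_1_left)
        ultimately show ?thesis
          by simp
      qed
      ultimately show ?thesis
        using 1 two_P by (intro exI[of _ b]) (auto simp: quad_char_def)
    next
      case 2
      obtain k where k: "m = j * k"
        using P(4)[OF 2(1)] by (elim dvdE)
      have "coprime j k"
        using squarefree_imp_coprime_prime m(1) k P(1)[OF 2(1)] by blast
      moreover have "coprime j 8"
        using P(3)[OF 2(1)] coprime_8_iff coprime_commute by blast
      ultimately have cop: "coprime j (8 * k)"
        by simp
      obtain a where a: "Legendre (int a) (int j) = - 1"
        using exists_nonresidue P(1,2) 2 by blast
      \<comment> \<open>A nonresidue modulo \<open>j\<close> that is 1 modulo 8 and modulo the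
        cofactor of \<open>j\<close> leaves all other characters at 1.\<close>
      obtain b where b: "[b = a] (mod j)" "[b = 1] (mod 8 * k)"
        using binary_chinese_remainder_nat[OF cop] by blast
      have "Legendre (int b) (int j) = - 1"
        using a Legendre_cong b(1) by (metis cong_int_iff)
      moreover have "Legendre (int b) (int i) = 1" if "i \<in> P" "i \<noteq> j" for i
      proof -
        have "i dvd k"
          using P[OF that(1)] P[OF 2(1)] that(2) k
          by (metis prime_dvd_mult_iff primes_dvd_imp_eq)
        then have "[b = 1] (mod i)"
          using b(2) cong_dvd_modulus_nat by (metis dvd_mult)
        then have "[int b = 1] (mod int i)"
          by (metis cong_int_iff of_nat_1)
        then show ?thesis
          using Legendre_cong Legendre_1[of "int i"] P(2)[OF that(1)] by force
      qed
      moreover have "neg_kronecker D b = 1"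
      proof -
        have "[b = 1] (mod 8)"
          using b(2) cong_dvd_modulus_nat by (metis dvd_triv_left)
        then show ?thesis
          by (simp add: neg_kronecker_def unique_euclidean_semiring_class.cong_def)
      qed
      moreover have "coprime b (8 * m)"
      proof -
        have "coprime b (8 * k)"
          using b(2) by (metis cong_imp_coprime cong_sym coprime_1_left)
        moreover have "\<not> j dvd b"
          using \<open>Legendre (int b) (int j) = - 1\<close> Legendre_eq_0_iff[of "int b" "int j"] by auto
        then have "coprime b j"
          using P(1)[OF 2(1)] prime_imp_coprime coprime_commute by blast
        ultimately show ?thesis
          by (simp add: k)
      qed
      ultimately show ?thesis
        using 2 by (intro exI[of _ b]) (auto simp: quad_char_def)
    qed
  qed

interpretation real_characters "8 * m" "insert 2 P" "quad_char D"
  by (rule real_characters_quad_char)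

text \<open>Quadratic reciprocity identifies the product of all characters at \<open>l\<close> with
  the Legendre symbol of \<open>- D * m\<close> modulo \<open>l\<close>. The factor 1 in the
  conclusion matches the shape of \<open>squarefree_quadratic_congruence\<close>.\<close>

lemma residue_mod_split_prime:
  assumes l: "prime l" and cop_l: "coprime l (8 * m)" and char_l: "\<Psi> (insert 2 P) l = 1"
  shows "\<exists>r. int l dvd 1 * r\<^sup>2 + int (D * m)"
proof -
  have l2: "2 < l"
    using coprime_M(1)[OF cop_l] prime_ge_2_nat[OF l] by (cases "l = 2") auto
  have lP: "l \<notin> P"
    using coprime_M(2)[OF cop_l, of l] by auto
  have "(\<Prod>j\<in>P. quad_char D j l) = real_of_int (\<Prod>p\<in>P. Legendre (int l) (int p))"
    unfolding of_int_prod using two_P by (intro prod.cong) (auto simp: quad_char_def)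
  then have "real_of_int (neg_kronecker D l * (\<Prod>p\<in>P. Legendre (int l) (int p))) = 1"
    using char_l cop_l finite_P two_P by (simp add: \<Psi>_def quad_char_def)
  then have 1: "neg_kronecker D l * (\<Prod>p\<in>P. Legendre (int l) (int p)) = 1"
    by linarith
  have "Legendre (int p) (int l) = Legendre (int l) (int p) * neg_kronecker 1 p ^ ((l - 1) div 2)"
    if p: "p \<in> P" for p
  proof -
    have "p \<noteq> l"
      using p lP by blast
    then have "Legendre (int p) (int l) * Legendre (int l) (int p) = neg_kronecker 1 p ^ ((l - 1) div 2)"
      using Quadratic_Reciprocity[OF P(1,2)[OF p] l l2] sigma_1_eq_power[OF P(3)[OF p]]
      by (simp add: power_mult)
    moreover have "Legendre (int l) (int p) \<noteq> 0"
      using coprime_M(2)[OF cop_l p] by (simp add: Legendre_eq_0_iff)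
    ultimately show ?thesis
      using Legendre_sign[of "int l" "int p"] by auto
  qed
  then have "(\<Prod>p\<in>P. Legendre (int p) (int l)) =
      (\<Prod>p\<in>P. Legendre (int l) (int p)) * (\<Prod>p\<in>P. neg_kronecker 1 p) ^ ((l - 1) div 2)"
    by (simp add: prod.distrib prod_power_distrib)
  then have 2: "(\<Prod>p\<in>P. Legendre (int p) (int l)) = (\<Prod>p\<in>P. Legendre (int l) (int p))"
    by (simp only: sigma_P power_one mult_1_right)
  have "Legendre (\<Prod>p\<in>Q. int p) (int l) = (\<Prod>p\<in>Q. Legendre (int p) (int l))" if "finite Q" for Q
    using that
  proof (induction Q rule: finite_induct)
    case empty
    then show ?case using l2 by (simp add: Legendre_1)
  next
    case (insert p Q)
    then show ?case by (simp add: Legendre_mult[OF l l2])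
  qed
  moreover have "int m = (\<Prod>p\<in>P. int p)"
    by (subst prod_P[symmetric]) simp
  ultimately have "Legendre (int m) (int l) = (\<Prod>p\<in>P. Legendre (int p) (int l))"
    using finite_P by simp
  then have "Legendre (- int D * int m) (int l) = 1"
    using Legendre_mult[OF l l2, of "- int D" "int m"] Legendre_minus_sigma[OF l l2 D] 1 2
    by simp
  then obtain r where "[r\<^sup>2 = - int D * int m] (mod int l)"
    unfolding Legendre_def QuadRes_def by (auto split: if_splits)
  then show ?thesis
    by (auto simp: cong_iff_dvd_diff)
qed

text \<open>\<open>q\<close> and \<open>n\<close> differ by a square factor, so \<open>- q\<close>
  is congruent to some \<open>y^2\<close> modulo \<open>p\<close>. With \<open>v\<close> an inverse
  of \<open>q\<close>, the choice \<open>t = y * v\<close> works.\<close>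

lemma residue_mod_P:
  assumes p: "p \<in> P" and n: "coprime n (8 * m)" "Legendre (int n) (int p) = Legendre (- 1) (int p)"
    and n_eq: "n = q * k\<^sup>2"
  shows "\<exists>t. int p dvd int q * t\<^sup>2 + 1"
proof -
  note mult = Legendre_mult[OF P(1,2)[OF p]]
  have "\<not> p dvd n"
    by (rule coprime_M(2)[OF n(1) p])
  then have nz: "\<not> p dvd k" "\<not> p dvd q"
    by (auto simp: n_eq power2_eq_square)
  have "Legendre (int n) (int p) = Legendre (int q) (int p) * (Legendre (int k) (int p))\<^sup>2"
    by (simp add: n_eq power2_eq_square mult)
  moreover have "(Legendre (int k) (int p))\<^sup>2 = 1"
    using nz(1) Legendre_sign[of "int k" "int p"] Legendre_eq_0_iff[of "int k" "int p"] by auto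
  ultimately have "Legendre (int q) (int p) = Legendre (- 1) (int p)"
    using n(2) by simp
  then have "Legendre (- 1 * int q) (int p) = 1"
    using mult[of "- 1" "int q"] Legendre_sign[of "int q" "int p"] nz(2)
      Legendre_eq_0_iff[of "int q" "int p"] by auto
  then obtain y where y: "[y\<^sup>2 = - int q] (mod int p)"
    unfolding Legendre_def QuadRes_def by (auto split: if_splits)
  have "coprime q p"
    using nz(2) P(1)[OF p] prime_imp_coprime coprime_commute by blast
  then obtain v where v: "[int q * v = 1] (mod int p)"
    using cong_solve_coprime_int[of "int q" "int p"] by auto
  have "int q * (y * v)\<^sup>2 = (int q * v) * v * y\<^sup>2"
    by (simp add: power2_eq_square algebra_simps)
  moreover have "[(int q * v) * v * y\<^sup>2 = 1 * v * (- int q)] (mod int p)"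
    by (intro cong_mult v y cong_refl)
  moreover have "[1 * v * (- int q) = - 1] (mod int p)"
  proof -
    have "[- (int q * v) = - 1] (mod int p)"
      using v by (simp only: cong_minus_minus_iff)
    then show ?thesis by (simp add: mult.commute)
  qed
  ultimately have "[int q * (y * v)\<^sup>2 = - 1] (mod int p)"
    using cong_trans by metis
  then show ?thesis
    by (intro exI[of _ "y * v"]) (simp add: cong_iff_dvd_diff)
qed

lemma three_squares_squarefree: "\<exists>x y z :: int. int (D * m) = x\<^sup>2 + y\<^sup>2 + z\<^sup>2"
proof -
  \<comment> \<open>At \<open>p\<close> dividing \<open>m\<close> the sign asks that
    \<open>- n\<close> be a square modulo \<open>p\<close>. These signs already have product 1, so
    the sign at 2 has to be 1.\<close>
  define \<epsilon> where "\<epsilon> = (\<lambda>j. if j = 2 then 1 else real_of_int (Legendre (- 1) (int j)))"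
  have eps_P: "\<epsilon> p = real_of_int (neg_kronecker 1 p)" if "p \<in> P" for p
    using that two_P Legendre_minus_sigma[OF P(1,2)[OF that], of 1] by (auto simp: \<epsilon>_def)
  have "\<epsilon> j = 1 \<or> \<epsilon> j = - 1" if "j \<in> insert 2 P" for j
  proof (cases "j = 2")
    case False
    then show ?thesis
      using that eps_P[of j] sigma_sign[of 1 j] by auto
  qed (simp add: \<epsilon>_def)
  moreover have "(\<Prod>j\<in>insert 2 P. \<epsilon> j) = 1"
  proof -
    have "(\<Prod>j\<in>P. \<epsilon> j) = real_of_int (\<Prod>p\<in>P. neg_kronecker 1 p)"
      unfolding of_int_prod using eps_P by (intro prod.cong) auto
    then have "(\<Prod>j\<in>P. \<epsilon> j) = 1"
      by (simp only: sigma_P of_int_1)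
    then show ?thesis
      using two_P finite_P by (simp add: \<epsilon>_def)
  qed
  ultimately obtain n where n: "n > 0" "coprime n (8 * m)" "R n \<noteq> 0"
    and signs: "\<forall>j\<in>insert 2 P. quad_char D j n = \<epsilon> j"
    using exists_prescribed_signs[of \<epsilon>] by blast
  define q k where "q = squarefree_part n" and "k = square_part n"
  have n_eq: "n = q * k\<^sup>2"
    unfolding q_def k_def by (rule squarefree_decompose)
  have q: "squarefree q" "q > 0"
    unfolding q_def by (auto simp: neq0_conv[symmetric] simp del: neq0_conv)
  have cop_q: "coprime q (8 * m)"
    using n(2) by (rule coprime_divisors[rotated 2]) (simp_all add: n_eq)
  have residue_q: "\<exists>r. int l dvd 1 * r\<^sup>2 + int (D * m)" if l: "prime l" "l dvd q" for l
  proof -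
    have cop_l: "coprime l (8 * m)"
      using cop_q l(2) by (rule coprime_divisors[rotated 2]) simp_all
    \<comment> \<open>A prime factor \<open>l\<close> of the squarefree part occurs in
      \<open>n\<close> to an odd power, so a character value -1 at \<open>l\<close> would make
      \<open>R n\<close> vanish.\<close>
    have "multiplicity l q > 0"
      using l q by (simp add: prime_multiplicity_gt_zero_iff)
    then have "odd (multiplicity l n)"
      unfolding q_def prime_multiplicity_squarefree_part[OF l(1)] by presburger
    then have "\<Psi> (insert 2 P) l \<noteq> - 1"
      using R_eq_0[OF n(1) l(1)] n(3) by blast
    then have "\<Psi> (insert 2 P) l = 1"
      using char_sign_coprime[OF subset_refl cop_l] by blast
    then show ?thesis
      by (rule residue_mod_split_prime[OF l(1) cop_l])
  qed
  have residue_m: "\<exists>t. int p dvd int q * t\<^sup>2 + 1" if p: "prime p" "p dvd D * m" for p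
  proof (cases "p = 2")
    \<comment> \<open>This case arises only for \<open>D = 2\<close>; as \<open>q\<close> is odd,
      \<open>t = 1\<close> works.\<close>
    case True
    then show ?thesis
      using coprime_M(1)[OF cop_q] by (intro exI[of _ 1]) simp
  next
    case False
    have "\<not> p dvd D"
      using p(1) False D primes_dvd_imp_eq[OF p(1) two_is_prime_nat] by auto
    then have "p \<in> P"
      using p m_pos by (simp add: P_def prime_dvd_mult_iff in_prime_factors_iff)
    moreover from this have "Legendre (int n) (int p) = Legendre (- 1) (int p)"
      using signs False by (auto simp: quad_char_def \<epsilon>_def)
    ultimately show ?thesis
      by (rule residue_mod_P[OF _ n(2) _ n_eq])
  qed
  have "coprime D m"
    using D odd_m by auto
  moreover have "squarefree D"
    using D squarefree_prime[OF two_is_prime_nat] by auto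
  ultimately have "squarefree (D * m)"
    using m(1) by (intro squarefree_mult_coprime)
  from squarefree_quadratic_congruence[OF this residue_m]
  obtain t where t: "int (D * m) dvd int q * t\<^sup>2 + 1"
    by blast
  from squarefree_quadratic_congruence[OF q(1) residue_q]
  obtain r where r: "int q dvd 1 * r\<^sup>2 + int (D * m)"
    by blast
  have "D * m dvd 8 * m"
    using D by (auto intro!: mult_dvd_mono)
  then have "coprime q (D * m)"
    by (rule coprime_divisors[OF dvd_refl _ cop_q])
  then have "coprime (int q) (int (D * m))"
    by (simp only: coprime_int_iff)
  moreover have "int (D * m) > 0"
    using D m_pos by auto
  ultimately show ?thesis
    using t r q(2) by (intro sum_three_squares_if_congruences[of "int q" _ t r]) simp_all
qed

end

text \<open>The square factor is the square of an odd number, hence 1 modulo 4, and the squarefree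
  part inherits the residue of \<open>s\<close>.\<close>

lemma three_squares:
  fixes s D :: nat
  assumes "s mod 4 = 1" and D: "D = 1 \<or> D = 2"
  shows "\<exists>x y z :: int. int (D * s) = x\<^sup>2 + y\<^sup>2 + z\<^sup>2"
proof -
  define m k where "m = squarefree_part s" and "k = square_part s"
  have s: "s = m * k\<^sup>2"
    unfolding m_def k_def by (rule squarefree_decompose)
  have "odd s"
    using assms(1) by presburger
  then have "odd k"
    using s by auto
  then have "k mod 4 = 1 \<or> k mod 4 = 3"
    by presburger
  then have "k\<^sup>2 mod 4 = 1"
    by (auto simp: power2_eq_square mod_mult_eq[of k 4 k, symmetric])
  then have "m mod 4 = 1"
    using assms(1) s by (metis mod_mult_right_eq mult.right_neutral)
  then obtain x y z :: int where "int (D * m) = x\<^sup>2 + y\<^sup>2 + z\<^sup>2"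
    using squarefree_modulus.three_squares_squarefree[of m D] D
    by (auto simp: squarefree_modulus_def m_def)
  then have "int (D * s) = (x\<^sup>2 + y\<^sup>2 + z\<^sup>2) * (int k)\<^sup>2"
    unfolding s by (metis mult.assoc of_nat_mult of_nat_power)
  also have "\<dots> = (x * int k)\<^sup>2 + (y * int k)\<^sup>2 + (z * int k)\<^sup>2"
    by (simp add: algebra_simps power_mult_distrib)
  finally show ?thesis
    by blast
qed

section \<open>Rational regular simplices\<close>

lemma nat_square_class:
  fixes n :: nat
  assumes "n > 0"
  obtains D s k where "D = 1 \<or> D = 2" "odd s" "k > 0" "n = D * s * k\<^sup>2"
proof -
  define e where "e = multiplicity 2 n"
  obtain s where s: "n = 2 ^ e * s" "odd s"
    using multiplicity_decompose'[of n 2] assms unfolding e_def by auto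
  have "(2 :: nat) ^ e = 2 ^ (e mod 2) * (2 ^ (e div 2))\<^sup>2"
    by (simp add: power_mult[symmetric] power_add[symmetric])
  then have "n = 2 ^ (e mod 2) * s * (2 ^ (e div 2))\<^sup>2"
    using s(1) by simp
  moreover have "(2 :: nat) ^ (e mod 2) = 1 \<or> (2 :: nat) ^ (e mod 2) = 2"
    by (cases "even e") (auto simp: odd_iff_mod_2_eq_one)
  ultimately show thesis
    using that[of "2 ^ (e mod 2)" s "2 ^ (e div 2)"] s(2) by simp
qed

lemma rat_square_class:
  fixes c :: rat
  assumes "c > 0"
  obtains D s :: nat and \<kappa> :: rat where "D = 1 \<or> D = 2" "odd s" "\<kappa> \<noteq> 0" "c = of_nat (D * s) * \<kappa>\<^sup>2"
proof -
  obtain a b where ab: "quotient_of c = (a, b)"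
    by (cases "quotient_of c")
  then have b: "b > 0" and c: "c = of_int a / of_int b"
    using quotient_of_denom_pos quotient_of_div by auto
  then have a: "a > 0"
    using assms by (simp add: zero_less_divide_iff)
  then have "nat (a * b) > 0"
    using b by simp
  then obtain D s k where Ds: "D = 1 \<or> D = 2" "odd s" "k > 0" "nat (a * b) = D * s * k\<^sup>2"
    by (rule nat_square_class)
  \<comment> \<open>Expanding the fraction by \<open>b\<close> shows that \<open>a * b\<close> lies
    in the square class of \<open>c\<close>.\<close>
  have "c = of_int (a * b) / (of_int b)\<^sup>2"
    using b c by (simp add: power2_eq_square)
  also have "(of_int (a * b) :: rat) = of_nat (nat (a * b))"
    using a b by simp
  also have "\<dots> / (of_int b)\<^sup>2 = of_nat (D * s) * (of_nat k / of_int b)\<^sup>2"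
    unfolding Ds(4) by (simp add: power_divide)
  finally show thesis
    using that[of D s "of_nat k / of_int b"] Ds b by simp
qed

lemma scaled_three_squares:
  fixes \<nu> :: rat and g D :: nat
  assumes "g mod 4 = 1" "D = 1 \<or> D = 2"
  obtains x y z where "of_nat (D * g) * \<nu>\<^sup>2 = x\<^sup>2 + y\<^sup>2 + z\<^sup>2"
proof -
  obtain x y z :: int where xyz: "int (D * g) = x\<^sup>2 + y\<^sup>2 + z\<^sup>2"
    using three_squares[OF assms] by blast
  have "(of_nat (D * g) :: rat) = of_int (int (D * g))"
    by (simp only: of_int_of_nat_eq)
  also have "\<dots> = (of_int x)\<^sup>2 + (of_int y)\<^sup>2 + (of_int z)\<^sup>2"
    unfolding xyz by simp
  finally have "of_nat (D * g) * \<nu>\<^sup>2 = (of_int x * \<nu>)\<^sup>2 + (of_int y * \<nu>)\<^sup>2 + (of_int z * \<nu>)\<^sup>2"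
    by (simp add: power_mult_distrib distrib_right)
  then show thesis
    by (rule that)
qed

text \<open>
  With \<open>N = 4 * k + 1\<close> and \<open>\<mu> = w / (u - w)\<close> the bracket is \<open>(u\<^sup>2 - N * w\<^sup>2) / (u - w)\<^sup>2\<close>.
  The choices \<open>(u, w) = (1, 0)\<close> and \<open>(u, w) = (2 * N, 1)\<close> have numerators 1 and
  \<open>(4 * k + 1) * (16 * k + 3)\<close>, of which the latter is congruent to 3 modulo 4.
\<close>

lemma apex_height:
  fixes c :: rat and k :: nat
  assumes "c > 0"
  obtains \<mu> x y z :: rat where "c * (1 + 2 * \<mu> - 4 * of_nat k * \<mu>\<^sup>2) = x\<^sup>2 + y\<^sup>2 + z\<^sup>2"
proof -
  obtain D s :: nat and \<kappa> :: rat where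
    Ds: "D = 1 \<or> D = 2" "odd s" "\<kappa> \<noteq> 0" "c = of_nat (D * s) * \<kappa>\<^sup>2"
    using rat_square_class[OF assms] by blast
  note scale = scaled_three_squares[OF _ Ds(1)]
  have "s mod 4 = 1 \<or> s mod 4 = 3"
    using Ds(2) by presburger
  then show thesis
  proof
    assume "s mod 4 = 1"
    from scale[OF this, of \<kappa>] obtain x y z where "c = x\<^sup>2 + y\<^sup>2 + z\<^sup>2"
      unfolding Ds(4) .
    then show thesis
      using that[of 0] by simp
  next
    assume s3: "s mod 4 = 3"
    define g where "g = (4 * k + 1) * (16 * k + 3)"
    \<comment> \<open>With \<open>N = 4 * k + 1\<close>, \<open>W\<close> is \<open>u - w\<close>
      for \<open>(u, w) = (2 * N, 1)\<close>, so that \<open>\<mu>\<close> is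
      \<open>1 / W\<close>.\<close>
    define W :: rat where "W = of_nat (8 * k + 1)"
    have "g = 3 + 4 * (7 * k + 16 * k * k)"
      by (simp add: g_def algebra_simps)
    moreover have "(3 + 4 * a) mod 4 = 3" for a :: nat
      by simp
    ultimately have "g mod 4 = 3"
      by (simp only:)
    then have "(s * g) mod 4 = 1"
      using s3 mod_mult_eq[of s 4 g] by simp
    from scale[OF this]
    obtain x y z where xyz: "of_nat (D * (s * g)) * (\<kappa> / W)\<^sup>2 = x\<^sup>2 + y\<^sup>2 + z\<^sup>2" .
    have "W \<noteq> 0"
      unfolding W_def by (simp only: of_nat_eq_0_iff)
    then have "1 + 2 * (1 / W) - 4 * of_nat k * (1 / W)\<^sup>2 = (W\<^sup>2 + 2 * W - 4 * of_nat k) / W\<^sup>2"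
      by (simp add: power2_eq_square add_divide_distrib diff_divide_distrib)
    also have "W\<^sup>2 + 2 * W - 4 * of_nat k = of_nat g"
      by (simp add: W_def g_def power2_eq_square algebra_simps)
    finally have "c * (1 + 2 * (1 / W) - 4 * of_nat k * (1 / W)\<^sup>2) = c * (of_nat g / W\<^sup>2)"
      by (simp only:)
    also have "\<dots> = of_nat (D * (s * g)) * (\<kappa> / W)\<^sup>2"
      unfolding Ds(4) by (simp add: power_divide)
    finally have "c * (1 + 2 * (1 / W) - 4 * of_nat k * (1 / W)\<^sup>2) = x\<^sup>2 + y\<^sup>2 + z\<^sup>2"
      unfolding xyz .
    then show thesis
      by (rule that)
  qed
qed

section \<open>Four rational squares and orthogonal rational vectors\<close>

lemma euler_four_squares:
  fixes a b c d p q r s :: "'a :: comm_ring_1"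
  shows "(a\<^sup>2 + b\<^sup>2 + c\<^sup>2 + d\<^sup>2) * (p\<^sup>2 + q\<^sup>2 + r\<^sup>2 + s\<^sup>2) =
    (a * p + b * q + c * r + d * s)\<^sup>2 + (a * q - b * p + c * s - d * r)\<^sup>2 +
    (a * r - b * s - c * p + d * q)\<^sup>2 + (a * s + b * r - c * q - d * p)\<^sup>2"
  by (simp add: power2_eq_square algebra_simps)

text \<open>If \<open>s\<close> is 3 modulo 4, three squares are available for \<open>3 * s\<close>.
  The compensating factor 3 is \<open>1 + 1 + 1 + 0\<close>, and Euler's identity multiplies the two
  sums.\<close>

lemma rat_four_squares:
  fixes c :: rat
  assumes "c > 0"
  obtains p q r s where "c = p\<^sup>2 + q\<^sup>2 + r\<^sup>2 + s\<^sup>2"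
proof -
  obtain D s :: nat and \<kappa> :: rat where
    Ds: "D = 1 \<or> D = 2" "odd s" "\<kappa> \<noteq> 0" "c = of_nat (D * s) * \<kappa>\<^sup>2"
    using rat_square_class[OF assms] by blast
  have "s mod 4 = 1 \<or> s mod 4 = 3"
    using Ds(2) by presburger
  then show thesis
  proof
    assume "s mod 4 = 1"
    from scaled_three_squares[OF this Ds(1), of \<kappa>] obtain x y z where "c = x\<^sup>2 + y\<^sup>2 + z\<^sup>2"
      unfolding Ds(4) .
    then show thesis
      using that[of x y z 0] by simp
  next
    assume "s mod 4 = 3"
    then have "(3 * s) mod 4 = 1"
      by presburger
    from scaled_three_squares[OF this Ds(1)]
    obtain x y z where xyz: "of_nat (D * (3 * s)) * (\<kappa> / 3)\<^sup>2 = x\<^sup>2 + y\<^sup>2 + z\<^sup>2" .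
    have "c = of_nat (D * (3 * s)) * (\<kappa> / 3)\<^sup>2 * 3"
      unfolding Ds(4) by (simp add: power_divide)
    also have "\<dots> = (x\<^sup>2 + y\<^sup>2 + z\<^sup>2 + 0\<^sup>2) * (1\<^sup>2 + 1\<^sup>2 + 1\<^sup>2 + 0\<^sup>2)"
      unfolding xyz by simp
    finally show thesis
      unfolding euler_four_squares by (rule that)
  qed
qed

text \<open>For the quaternion \<open>a\<close> with coordinates \<open>p, q, r, s\<close>, the rows
  are the coordinates of \<open>a\<close>, \<open>i * a\<close>, \<open>j * a\<close> and
  \<open>k * a\<close>.\<close>

definition quat_matrix :: "rat \<Rightarrow> rat \<Rightarrow> rat \<Rightarrow> rat \<Rightarrow> nat \<Rightarrow> nat \<Rightarrow> rat" where
  "quat_matrix p q r s i j =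
     [[p, q, r, s], [- q, p, - s, r], [- r, s, p, - q], [- s, - r, q, p]] ! i ! j"

lemma quat_matrix_orthogonal:
  assumes "i < 4" "i' < 4"
  shows "(\<Sum>j<4. quat_matrix p q r s i j * quat_matrix p q r s i' j) =
    (if i = i' then p\<^sup>2 + q\<^sup>2 + r\<^sup>2 + s\<^sup>2 else 0)"
proof -
  have "i \<in> {0, 1, 2, 3}" "i' \<in> {0, 1, 2, 3}"
    using assms by auto
  then show ?thesis
    by (auto simp: quat_matrix_def eval_nat_numeral power2_eq_square)
qed

lemma orthogonal_family:
  fixes c :: rat and k :: nat
  assumes "c > 0"
  obtains v :: "nat \<Rightarrow> nat \<Rightarrow> rat" where
    "\<And>i i'. i < 4 * k \<Longrightarrow> i' < 4 * k \<Longrightarrow> (\<Sum>j<4 * k. v i j * v i' j) = (if i = i' then c else 0)"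
proof -
  obtain p q r s where c: "c = p\<^sup>2 + q\<^sup>2 + r\<^sup>2 + s\<^sup>2"
    using rat_four_squares[OF assms] .
  define Q where "Q = quat_matrix p q r s"
  \<comment> \<open>A block-diagonal matrix with \<open>k\<close> copies of the quaternion
    block.\<close>
  define v where "v = (\<lambda>i j. if i div 4 = j div 4 then Q (i mod 4) (j mod 4) else 0)"
  have "(\<Sum>j<4 * k. v i j * v i' j) = (if i = i' then c else 0)"
    if "i < 4 * k" "i' < 4 * k" for i i'
  proof -
    have block: "(\<Sum>j\<in>{b * 4..<b * 4 + 4}. v i j * v i' j) =
        (if i div 4 = b \<and> i' div 4 = b then (if i mod 4 = i' mod 4 then c else 0) else 0)" for b
    proof -
      have "(\<Sum>j\<in>{b * 4..<b * 4 + 4}. v i j * v i' j) = (\<Sum>t<4. v i (b * 4 + t) * v i' (b * 4 + t))"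
        by (rule sum.reindex_bij_witness[of _ "\<lambda>t. b * 4 + t" "\<lambda>j. j - b * 4"]) auto
      also have "\<dots> = (\<Sum>t<4. if i div 4 = b \<and> i' div 4 = b then Q (i mod 4) t * Q (i' mod 4) t else 0)"
        by (intro sum.cong) (auto simp: v_def)
      also have "\<dots> = (if i div 4 = b \<and> i' div 4 = b then (if i mod 4 = i' mod 4 then c else 0) else 0)"
        using quat_matrix_orthogonal[of "i mod 4" "i' mod 4" p q r s]
        by (cases "i div 4 = b \<and> i' div 4 = b") (auto simp: Q_def c)
      finally show ?thesis .
    qed
    have "(\<Sum>j<4 * k. v i j * v i' j) = (\<Sum>b<k. \<Sum>j\<in>{b * 4..<b * 4 + 4}. v i j * v i' j)"
      by (subst sum.nat_group) (simp add: mult.commute)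
    also have "\<dots> = (\<Sum>b<k. if b = i div 4 then
        (if i' div 4 = i div 4 \<and> i mod 4 = i' mod 4 then c else 0) else 0)"
      unfolding block by (intro sum.cong) auto
    also have "\<dots> = (if i' div 4 = i div 4 \<and> i mod 4 = i' mod 4 then c else 0)"
      using that by (simp add: less_mult_imp_div_less mult.commute)
    also have "\<dots> = (if i = i' then c else 0)"
      by (metis div_mod_decomp)
    finally show ?thesis .
  qed
  then show thesis
    by (rule that)
qed

section \<open>Simplices built from orthogonal vectors\<close>

definition simplex_points :: "nat \<Rightarrow> nat \<Rightarrow> rat \<Rightarrow> (nat \<Rightarrow> nat \<Rightarrow> rat) \<Rightarrow> bool" where
  "simplex_points n N \<delta> w \<longleftrightarrow>
     (\<forall>i<N. \<forall>i'<N. i \<noteq> i' \<longrightarrow> (\<Sum>j<n. (w i j - w i' j)\<^sup>2) = \<delta>)"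

lemma sum_square_diff:
  fixes a b :: "nat \<Rightarrow> 'a :: comm_ring_1"
  shows "(\<Sum>j<n. (a j - b j)\<^sup>2) = (\<Sum>j<n. a j * a j) - 2 * (\<Sum>j<n. a j * b j) + (\<Sum>j<n. b j * b j)"
  by (induction n) (simp_all add: power2_eq_square algebra_simps)

lemma exists_simplex_4k:
  fixes c :: rat and n k :: nat
  assumes "c > 0" "4 * k \<le> n"
  shows "\<exists>w. simplex_points n (4 * k) (2 * c) w"
proof -
  obtain v :: "nat \<Rightarrow> nat \<Rightarrow> rat" where
    v: "\<And>i i'. i < 4 * k \<Longrightarrow> i' < 4 * k \<Longrightarrow> (\<Sum>j<4 * k. v i j * v i' j) = (if i = i' then c else 0)"
    using orthogonal_family[OF assms(1), where k = k] by blast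
  define w where "w = (\<lambda>i j. if j < 4 * k then v i j else 0)"
  have "(\<Sum>j<n. (w i j - w i' j)\<^sup>2) = 2 * c" if "i < 4 * k" "i' < 4 * k" "i \<noteq> i'" for i i'
  proof -
    have "(\<Sum>j<n. (w i j - w i' j)\<^sup>2) = (\<Sum>j<4 * k. (v i j - v i' j)\<^sup>2)"
      using assms(2) by (intro sum.mono_neutral_cong_right) (auto simp: w_def)
    then show ?thesis
      using v that by (simp add: sum_square_diff)
  qed
  then show ?thesis
    unfolding simplex_points_def by blast
qed

text \<open>With \<open>\<mu>\<close> times the sum of the base vectors in the first coordinates and
  \<open>(x, y, z)\<close> in the last three, the apex has squared distance
  \<open>4 * k * \<mu>^2 * c - 2 * \<mu> * c + c + x^2 + y^2 + z^2\<close> from each base vertex.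
  This is \<open>2 * c\<close> exactly under the equation solved by
  \<open>apex_height\<close>.\<close>

lemma exists_simplex_4k_3:
  fixes c :: rat and k :: nat
  assumes "c > 0"
  shows "\<exists>w. simplex_points (4 * k + 3) (4 * k + 1) (2 * c) w"
proof -
  obtain v :: "nat \<Rightarrow> nat \<Rightarrow> rat" where
    v: "\<And>i i'. i < 4 * k \<Longrightarrow> i' < 4 * k \<Longrightarrow> (\<Sum>j<4 * k. v i j * v i' j) = (if i = i' then c else 0)"
    using orthogonal_family[OF assms(1), where k = k] by blast
  obtain \<mu> x y z where \<mu>: "c * (1 + 2 * \<mu> - 4 * of_nat k * \<mu>\<^sup>2) = x\<^sup>2 + y\<^sup>2 + z\<^sup>2"
    using apex_height[OF assms(1), where k = k] .
  define u where "u = (\<lambda>j. \<mu> * (\<Sum>l<4 * k. v l j))"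
  define apex where "apex = (\<lambda>j. if j < 4 * k then u j else [x, y, z] ! (j - 4 * k))"
  define w where "w = (\<lambda>i j. if i = 4 * k then apex j else if j < 4 * k then v i j else 0)"
  have uv: "(\<Sum>j<4 * k. u j * v i j) = \<mu> * c" if "i < 4 * k" for i
  proof -
    have "(\<Sum>j<4 * k. u j * v i j) = (\<Sum>j<4 * k. \<Sum>l<4 * k. \<mu> * (v l j * v i j))"
      by (simp add: u_def sum_distrib_left sum_distrib_right mult.assoc)
    also have "\<dots> = (\<Sum>l<4 * k. \<mu> * (\<Sum>j<4 * k. v l j * v i j))"
      unfolding sum_distrib_left by (rule sum.swap)
    also have "\<dots> = (\<Sum>l<4 * k. if l = i then \<mu> * c else 0)"
      using v that by (intro sum.cong) auto
    also have "\<dots> = \<mu> * c"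
      using that by simp
    finally show ?thesis .
  qed
  have uu: "(\<Sum>j<4 * k. u j * u j) = 4 * of_nat k * \<mu>\<^sup>2 * c"
  proof -
    have "(\<Sum>j<4 * k. u j * u j) = (\<Sum>j<4 * k. \<Sum>l<4 * k. \<mu> * (u j * v l j))"
      by (subst (2) u_def) (simp add: sum_distrib_left mult_ac)
    also have "\<dots> = (\<Sum>l<4 * k. \<mu> * (\<Sum>j<4 * k. u j * v l j))"
      unfolding sum_distrib_left by (rule sum.swap)
    also have "\<dots> = (\<Sum>l<4 * k. \<mu> * (\<mu> * c))"
      using uv by (intro sum.cong) auto
    also have "\<dots> = 4 * of_nat k * \<mu>\<^sup>2 * c"
      by (simp add: power2_eq_square)
    finally show ?thesis .
  qed
  have split: "(\<Sum>j<4 * k + 3. f j) = (\<Sum>j<4 * k. f j) + (f (4 * k) + f (4 * k + 1) + f (4 * k + 2))"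
    for f :: "nat \<Rightarrow> rat"
    by (simp add: eval_nat_numeral)
  have base: "(\<Sum>j<4 * k + 3. (w i j - w i' j)\<^sup>2) = 2 * c" if "i < 4 * k" "i' < 4 * k" "i \<noteq> i'" for i i'
    unfolding split using v that by (simp add: w_def sum_square_diff)
  have top: "(\<Sum>j<4 * k + 3. (w (4 * k) j - w i j)\<^sup>2) = 2 * c" if "i < 4 * k" for i
  proof -
    have "(\<Sum>j<4 * k + 3. (w (4 * k) j - w i j)\<^sup>2) =
        (\<Sum>j<4 * k. (u j - v i j)\<^sup>2) + (x\<^sup>2 + y\<^sup>2 + z\<^sup>2)"
      unfolding split using that by (simp add: w_def apex_def)
    also have "\<dots> = 2 * c"
      unfolding sum_square_diff uu uv[OF that] v[OF that that] \<mu>[symmetric]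
      by (simp add: algebra_simps)
    finally show ?thesis .
  qed
  have "(\<Sum>j<4 * k + 3. (w i j - w i' j)\<^sup>2) = 2 * c" if ii': "i < 4 * k + 1" "i' < 4 * k + 1" "i \<noteq> i'" for i i'
  proof -
    consider "i < 4 * k" "i' < 4 * k" | "i = 4 * k" "i' < 4 * k" | "i < 4 * k" "i' = 4 * k"
      using ii' by linarith
    then show ?thesis
    proof cases
      case 3
      then have "(\<Sum>j<4 * k + 3. (w i j - w i' j)\<^sup>2) = (\<Sum>j<4 * k + 3. (w i' j - w i j)\<^sup>2)"
        by (intro sum.cong) (simp_all add: power2_commute)
      with 3 top show ?thesis by simp
    qed (use base top ii' in auto)
  qed
  then show ?thesis
    unfolding simplex_points_def by blast
qed

text \<open>The residue 3 is separate because \<open>4 * k\<close> points would fall short of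
  \<open>n - 2\<close> by one.\<close>

lemma exists_simplex:
  fixes c :: rat and n :: nat
  assumes "c > 0"
  shows "\<exists>N w. n \<le> N + 2 \<and> simplex_points n N (2 * c) w"
proof (cases "n mod 4 = 3")
  case True
  define k where "k = n div 4"
  have "n = 4 * k + 3"
    using True div_mult_mod_eq[of n 4] by (simp add: k_def)
  then show ?thesis
    using exists_simplex_4k_3[OF assms, of k] by fastforce
next
  case False
  define k where "k = n div 4"
  have "n mod 4 \<le> 2"
    using False mod_less_divisor[of 4 n] by linarith
  then have "n \<le> 4 * k + 2" "4 * k \<le> n"
    using div_mult_mod_eq[of n 4] unfolding k_def by linarith+
  then show ?thesis
    using exists_simplex_4k[OF assms] by blast
qed

section \<open>Clique numbers\<close>

text \<open>The differences to a fixed vertex have inner products \<open>d^2\<close> on and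
  \<open>d^2 / 2\<close> off the diagonal. Pairing a linear relation with each of them shows that
  every coefficient is the negative of the coefficient sum \<open>U\<close>, and adding up gives
  \<open>U = 0\<close>.\<close>

lemma equidistant_card_le:
  fixes S :: "'a :: euclidean_space set"
  assumes "finite S" "d > 0" "pairwise (\<lambda>x y. dist x y = d) S"
  shows "card S \<le> DIM('a) + 1"
proof (cases "S = {}")
  case False
  then obtain x0 where x0: "x0 \<in> S" by blast
  define B where "B = (\<lambda>y. y - x0) ` (S - {x0})"
  have finite_B: "finite B"
    using assms(1) by (simp add: B_def)
  have norm_B: "b \<bullet> b = d\<^sup>2" if "b \<in> B" for b
  proof -
    obtain y where "y \<in> S" "y \<noteq> x0" "b = y - x0"
      using \<open>b \<in> B\<close> by (auto simp: B_def)
    then have "norm b = d"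
      using assms(3) x0 by (auto simp: pairwise_def dist_norm)
    then show ?thesis
      by (simp add: power2_norm_eq_inner[symmetric])
  qed
  have inner_B: "b \<bullet> b' = d\<^sup>2 / 2" if bb': "b \<in> B" "b' \<in> B" "b \<noteq> b'" for b b'
  proof -
    obtain y y' where "y \<in> S" "b = y - x0" "y' \<in> S" "b' = y' - x0"
      using bb'(1,2) by (auto simp: B_def)
    then have "norm (b - b') = d"
      using assms(3) bb'(3) by (auto simp: pairwise_def dist_norm)
    then have "(b - b') \<bullet> (b - b') = d\<^sup>2"
      by (simp add: power2_norm_eq_inner[symmetric])
    then show ?thesis
      using norm_B[OF bb'(1)] norm_B[OF bb'(2)]
      by (simp add: inner_diff_left inner_diff_right inner_commute)
  qed
  have "independent B"
  proof (rule independent_if_scalars_zero[OF finite_B])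
    fix u b
    assume sum0: "(\<Sum>x\<in>B. u x *\<^sub>R x) = 0" and b: "b \<in> B"
    define U e where "U = sum u B" and "e = d\<^sup>2 / 2"
    have norm_B': "x \<bullet> x = e + e" if "x \<in> B" for x
      using norm_B[OF that] by (simp add: e_def)
    have all: "u b' = - U" if b': "b' \<in> B" for b'
    proof -
      have "0 = (\<Sum>x\<in>B. u x *\<^sub>R x) \<bullet> b'"
        using sum0 by simp
      also have "\<dots> = (\<Sum>x\<in>B. u x * (x \<bullet> b'))"
        by (simp add: inner_sum_left)
      also have "\<dots> = (\<Sum>x\<in>B. u x * e + (if x = b' then u b' * e else 0))"
        using norm_B' inner_B b' by (intro sum.cong) (auto simp: e_def[symmetric] distrib_left)
      also have "\<dots> = (U + u b') * e"
        using finite_B b' by (simp add: sum.distrib U_def sum_distrib_right[symmetric] distrib_right)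
      finally show ?thesis
        using assms(2) by (simp add: e_def)
    qed
    have "U = (\<Sum>x\<in>B. - U)"
      by (subst U_def, rule sum.cong[OF refl], rule all)
    also have "\<dots> = - (real (card B) * U)"
      by simp
    finally have "U + real (card B) * U = 0"
      by linarith
    then have "(1 + real (card B)) * U = 0"
      by (simp only: distrib_right mult_1)
    then have "U = 0"
      by (simp add: add_nonneg_eq_0_iff)
    with all[OF b] show "u b = 0"
      by simp
  qed
  then have "card B \<le> DIM('a)"
    using independent_bound by blast
  moreover have "card B = card S - 1"
    unfolding B_def using assms(1) x0 by (subst card_image) (auto simp: inj_on_def)
  ultimately show ?thesis
    by linarith
qed simp

lemma dist_clique_card_le:
  fixes X :: "(real ^ 'n) set"
  assumes "d > 0" "finite S" "dist_clique X d S"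
  shows "card S \<le> CARD('n) + 1"
proof -
  have "pairwise (\<lambda>x y. dist x y = d) S"
    using assms(3) by (simp add: dist_clique_def dist_adj_def pairwise_def)
  then show ?thesis
    using equidistant_card_le[OF assms(2,1)] by simp
qed

lemma finite_clique_sizes:
  fixes X :: "(real ^ 'n) set"
  assumes "d > 0"
  shows "finite {card S | S. finite S \<and> dist_clique X d S}"
  by (rule finite_subset[of _ "{..CARD('n) + 1}"]) (auto dest: dist_clique_card_le[OF assms])

lemma dist_clique_number_le:
  fixes X :: "(real ^ 'n) set"
  assumes "d > 0"
  shows "dist_clique_number X d \<le> CARD('n) + 1"
  unfolding dist_clique_number_def
proof (subst Max_le_iff[OF finite_clique_sizes[OF assms]])
  have "dist_clique X d {}"
    by (simp add: dist_clique_def)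
  then show "{card S |S. finite S \<and> dist_clique X d S} \<noteq> {}"
    by blast
qed (auto dest: dist_clique_card_le[OF assms])

lemma dist_clique_number_ge:
  fixes w :: "nat \<Rightarrow> nat \<Rightarrow> rat"
  assumes "d > 0" "simplex_points CARD('n) N \<delta> w" "d\<^sup>2 = of_rat \<delta>"
  shows "N \<le> dist_clique_number (rational_points :: (real ^ 'n) set) d"
proof -
  obtain h :: "'n \<Rightarrow> nat" where h: "bij_betw h UNIV {0..<CARD('n)}"
    using ex_bij_betw_finite_nat[of "UNIV :: 'n set"] by auto
  define p :: "nat \<Rightarrow> real ^ 'n" where "p = (\<lambda>i. \<chi> a. of_rat (w i (h a)))"
  have dist_p: "dist (p i) (p i') = d" if "i < N" "i' < N" "i \<noteq> i'" for i i'
  proof -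
    have "(dist (p i) (p i'))\<^sup>2 = (\<Sum>a\<in>UNIV. (of_rat (w i (h a)) - of_rat (w i' (h a)))\<^sup>2)"
      by (simp add: dist_vec_def L2_set_def p_def dist_real_def sum_nonneg)
    also have "\<dots> = (\<Sum>j\<in>{0..<CARD('n)}. (of_rat (w i j) - of_rat (w i' j))\<^sup>2)"
      by (rule sum.reindex_bij_betw[OF h])
    also have "\<dots> = of_rat (\<Sum>j<CARD('n). (w i j - w i' j)\<^sup>2)"
      by (simp add: of_rat_sum of_rat_power of_rat_diff atLeast0LessThan)
    also have "\<dots> = d\<^sup>2"
      using assms(2,3) that by (simp add: simplex_points_def)
    finally show ?thesis
      using assms(1) by (simp add: power2_eq_iff_nonneg)
  qed
  have inj: "inj_on p {..<N}"
  proof (rule inj_onI, rule ccontr)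
    fix i i' assume "i \<in> {..<N}" "i' \<in> {..<N}" "p i = p i'" "i \<noteq> i'"
    then show False
      using dist_p[of i i'] assms(1) by simp
  qed
  have "p i \<in> rational_points" for i
    by (simp add: p_def rational_points_def)
  then have "dist_clique rational_points d (p ` {..<N})"
    unfolding dist_clique_def pairwise_def dist_adj_def using dist_p by auto
  then have "card (p ` {..<N}) \<in>
      {card S | S. finite S \<and> dist_clique (rational_points :: (real ^ 'n) set) d S}"
    by blast
  from Max_ge[OF finite_clique_sizes[OF assms(1)] this] show ?thesis
    unfolding dist_clique_number_def by (simp add: card_image[OF inj])
qed

text \<open>A realized distance has a rational square, so \<open>exists_simplex\<close> applies with
  half of that square as \<open>c\<close>.\<close>

lemma realized_clique_number_ge:
  fixes x y :: "real ^ 'n"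
  assumes "x \<in> rational_points" "y \<in> rational_points" "dist x y = d" "d > 0"
  shows "CARD('n) \<le> dist_clique_number (rational_points :: (real ^ 'n) set) d + 2"
proof -
  have "d\<^sup>2 = (\<Sum>i\<in>UNIV. (x $ i - y $ i)\<^sup>2)"
    unfolding assms(3)[symmetric] by (simp add: dist_vec_def L2_set_def dist_real_def sum_nonneg)
  also have "\<dots> \<in> \<rat>"
    using assms(1,2) by (intro Rats_sum) (auto simp: rational_points_def intro!: Rats_power Rats_diff)
  finally obtain \<delta> where \<delta>: "d\<^sup>2 = of_rat \<delta>"
    by (elim Rats_cases)
  have "of_rat \<delta> > (0 :: real)"
    using assms(4) \<delta> by (metis zero_less_power)
  then have "\<delta> / 2 > 0"
    by simp
  from exists_simplex[OF this, of "CARD('n)"] obtain N w where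
    "CARD('n) \<le> N + 2" "simplex_points CARD('n) N \<delta> w"
    by auto
  moreover from this have "N \<le> dist_clique_number (rational_points :: (real ^ 'n) set) d"
    using assms(4) \<delta> by (intro dist_clique_number_ge)
  ultimately show ?thesis
    by linarith
qed

lemma upper_clique_number_le: "upper_clique_number (X :: (real ^ 'n) set) \<le> CARD('n) + 1"
proof -
  have fin: "finite {dist_clique_number X d | d. d > 0}"
    by (rule finite_subset[of _ "{..CARD('n) + 1}"]) (use dist_clique_number_le in blast, simp)
  have "dist_clique_number X 1 \<in> {dist_clique_number X d | d. d > 0}"
    using zero_less_one by blast
  then have "{dist_clique_number X d | d. d > 0} \<noteq> {}"
    by blast
  moreover have "\<forall>a\<in>{dist_clique_number X d | d. d > 0}. a \<le> CARD('n) + 1"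
    using dist_clique_number_le by blast
  ultimately show ?thesis
    unfolding upper_clique_number_def using Max_in[OF fin] by blast
qed

lemma lower_clique_number_ge:
  "CARD('n) \<le> lower_clique_number (rational_points :: (real ^ 'n) set) + 2"
proof -
  let ?X = "rational_points :: (real ^ 'n) set"
  let ?A = "{dist_clique_number ?X d | d. d > 0 \<and> (\<exists>x\<in>?X. \<exists>y\<in>?X. dist x y = d)}"
  have "?A \<subseteq> {..CARD('n) + 1}"
    using dist_clique_number_le by blast
  then have "finite ?A"
    by (rule finite_subset) simp
  moreover have "?A \<noteq> {}"
  proof -
    \<comment> \<open>The distance 1 is realized, so the minimum is taken over a nonempty set and is
      attained.\<close>
    have "0 \<in> ?X" "axis undefined 1 \<in> ?X"
      by (auto simp: rational_points_def axis_def)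
    moreover have "dist (0 :: real ^ 'n) (axis undefined 1) = 1"
      by (simp add: dist_norm)
    ultimately have "\<exists>x\<in>?X. \<exists>y\<in>?X. dist x y = 1"
      by blast
    then have "dist_clique_number ?X 1 \<in> ?A"
      using zero_less_one by blast
    then show ?thesis
      by (metis empty_iff)
  qed
  ultimately have "Min ?A \<in> ?A"
    by (rule Min_in)
  then obtain d x y where d: "Min ?A = dist_clique_number ?X d" "d > 0"
    and xy: "x \<in> ?X" "y \<in> ?X" "dist x y = d"
    by blast
  show ?thesis
    unfolding lower_clique_number_def d(1) by (rule realized_clique_number_ge[OF xy d(2)])
qed

theorem theorem4p2:
  "int (upper_clique_number (rational_points :: (real ^ 'n) set))
     - int (lower_clique_number (rational_points :: (real ^ 'n) set)) \<le> 3"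
  using upper_clique_number_le[of "rational_points :: (real ^ 'n) set"]
    lower_clique_number_ge[where 'n = 'n]
  by linarith

end
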